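(* Let $D_G$ be a weighted oriented graph with underlying graph $G$ on vertices $x_1,\ldots,x_n$. If $I(D_G)^{\vee}$ is Cohen-Macaulay (i.e. $K[x_1,\ldots,x_n]/I(D_G)^{\vee}$ is Cohen-Macaulay), then the complement graph $\overline G$ is chordal.
   Context: A weighted oriented graph $D_G$ with underlying simple graph $G$ is an orientation of the edges with weights $w(k)=w(x_k)\in\mathbb{Z}_{>0}$; $(x_i,x_j)$ denotes an edge oriented from $x_i$ to $x_j$; sources have weight $1$ by convention. $I(D_G)=\langle x_ix_j^{w(j)}:(x_i,x_j)\in E(D_G)\rangle\subseteq K[x_1,\ldots,x_n]$, $K$ a field. A graph is chordal if every induced cycle of length $\ge4$ has a chord. Alexander dual (Miller): for $\mathbf b\in\mathbb N^n$, $\mathbf m^{\mathbf b}=\langle x_i^{b_i}:b_i\ge1\rangle$; $\mathrm{Irr}(I)$ is the set of irreducible components in the irredundant irreducible decomposition of the monomial ideal $I$; $\mathbf a_I$ is the exponent vector of the lcm of the minimal generators of $I$; for $\mathbf 0\preceq\mathbf b\preceq\mathbf a$, $(\mathbf b^{\mathbf a})_i=a_i+1-b_i$ if $b_i\ge1$ and $0$ otherwise; $I^{\vee}=\langle\mathbf x^{\mathbf b^{\mathbf a_I}}:\mathbf m^{\mathbf b}\in\mathrm{Irr}(I)\rangle$. *)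

theory Defs
  imports Main "HOL-Library.Poly_Mapping" "HOL-Library.Extended_Nat"
begin

type_synonym ('v, 'k) mpoly = "('v \<Rightarrow>\<^sub>0 nat) \<Rightarrow>\<^sub>0 'k"

definition Var :: "'v \<Rightarrow> ('v, 'k::comm_ring_1) mpoly" where
  "Var i = Poly_Mapping.single (Poly_Mapping.single i 1) 1"

definition monom :: "('v::finite \<Rightarrow> nat) \<Rightarrow> ('v, 'k::comm_ring_1) mpoly" where
  "monom e = Poly_Mapping.single (Abs_poly_mapping e) 1"

definition is_ideal :: "'r::comm_ring_1 set \<Rightarrow> bool" where
  "is_ideal I \<longleftrightarrow> 0 \<in> I \<and> (\<forall>a\<in>I. \<forall>b\<in>I. a + b \<in> I) \<and> (\<forall>r. \<forall>a\<in>I. r * a \<in> I)"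

definition ideal_gen :: "'r::comm_ring_1 set \<Rightarrow> 'r set" where
  "ideal_gen S = \<Inter>{I. is_ideal I \<and> S \<subseteq> I}"

definition is_prime_ideal :: "'r::comm_ring_1 set \<Rightarrow> bool" where
  "is_prime_ideal P \<longleftrightarrow> is_ideal P \<and> 1 \<notin> P \<and> (\<forall>a b. a * b \<in> P \<longrightarrow> a \<in> P \<or> b \<in> P)"

definition krull_dim_quot :: "'r::comm_ring_1 set \<Rightarrow> enat" where
  "krull_dim_quot J = (SUP ps \<in> {ps. ps \<noteq> [] \<and> (\<forall>P\<in>set ps. is_prime_ideal P \<and> J \<subseteq> P)
                                  \<and> sorted_wrt (\<subset>) ps}. enat (length ps - 1))"

definition max_ideal :: "('v, 'k::comm_ring_1) mpoly set" where
  "max_ideal = {p. Poly_Mapping.lookup p 0 = 0}"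

definition regular_seq_quot :: "('v, 'k::comm_ring_1) mpoly set \<Rightarrow> ('v, 'k) mpoly list \<Rightarrow> bool" where
  "regular_seq_quot J fs \<longleftrightarrow> set fs \<subseteq> max_ideal \<and> ideal_gen (J \<union> set fs) \<noteq> UNIV \<and>
     (\<forall>i < length fs. \<forall>g. fs ! i * g \<in> ideal_gen (J \<union> set (take i fs))
                         \<longrightarrow> g \<in> ideal_gen (J \<union> set (take i fs)))"

definition depth_quot :: "('v, 'k::comm_ring_1) mpoly set \<Rightarrow> enat" where
  "depth_quot J = (SUP fs \<in> {fs. regular_seq_quot J fs}. enat (length fs))"

text \<open>R/J (J homogeneous) is Cohen-Macaulay iff depth_m(R/J) = dim(R/J).\<close>
definition cohen_macaulay_quot :: "('v, 'k::comm_ring_1) mpoly set \<Rightarrow> bool" where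
  "cohen_macaulay_quot J \<longleftrightarrow> depth_quot J = krull_dim_quot J"

definition irr_ideal :: "('v::finite \<Rightarrow> nat) \<Rightarrow> ('v, 'k::comm_ring_1) mpoly set" where
  "irr_ideal b = ideal_gen {Var i ^ b i | i. b i \<ge> 1}"

definition is_irr_decomp :: "('v, 'k::comm_ring_1) mpoly set \<Rightarrow> ('v::finite \<Rightarrow> nat) set \<Rightarrow> bool" where
  "is_irr_decomp I B \<longleftrightarrow> finite B \<and> I = \<Inter>{irr_ideal b | b. b \<in> B} \<and>
     (\<forall>b\<in>B. \<Inter>{irr_ideal c | c. c \<in> B - {b}} \<noteq> I)"

definition Irr :: "('v::finite, 'k::comm_ring_1) mpoly set \<Rightarrow> ('v \<Rightarrow> nat) set" where
  "Irr I = (SOME B. is_irr_decomp I B)"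

definition min_gens :: "('v::finite, 'k::comm_ring_1) mpoly set \<Rightarrow> ('v \<Rightarrow> nat) set" where
  "min_gens I = {a. monom a \<in> I \<and> (\<forall>c. monom c \<in> I \<and> c \<le> a \<longrightarrow> c = a)}"

definition lcm_exp :: "('v::finite, 'k::comm_ring_1) mpoly set \<Rightarrow> 'v \<Rightarrow> nat" where
  "lcm_exp I i = Max (insert 0 {a i | a. a \<in> min_gens I})"

definition dual_exp :: "('v \<Rightarrow> nat) \<Rightarrow> ('v \<Rightarrow> nat) \<Rightarrow> 'v \<Rightarrow> nat" where
  "dual_exp a b i = (if b i \<ge> 1 then a i + 1 - b i else 0)"

definition alexander_dual :: "('v::finite, 'k::comm_ring_1) mpoly set \<Rightarrow> ('v, 'k) mpoly set" where
  "alexander_dual I = ideal_gen {monom (dual_exp (lcm_exp I) b) | b. b \<in> Irr I}"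

text \<open>E: set of oriented edges (i,j) = from x_i to x_j; w: weights.\<close>
definition weighted_oriented_graph :: "('v \<times> 'v) set \<Rightarrow> ('v \<Rightarrow> nat) \<Rightarrow> bool" where
  "weighted_oriented_graph E w \<longleftrightarrow>
     (\<forall>i j. (i, j) \<in> E \<longrightarrow> i \<noteq> j \<and> (j, i) \<notin> E) \<and>
     (\<forall>v. w v > 0) \<and>
     (\<forall>v. (\<nexists>u. (u, v) \<in> E) \<longrightarrow> w v = 1)"

definition underlying_adj :: "('v \<times> 'v) set \<Rightarrow> 'v \<Rightarrow> 'v \<Rightarrow> bool" where
  "underlying_adj E u v \<longleftrightarrow> (u, v) \<in> E \<or> (v, u) \<in> E"

definition complement_adj :: "('v \<Rightarrow> 'v \<Rightarrow> bool) \<Rightarrow> 'v \<Rightarrow> 'v \<Rightarrow> bool" where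
  "complement_adj adj u v \<longleftrightarrow> u \<noteq> v \<and> \<not> adj u v"

definition edge_ideal :: "('v \<times> 'v) set \<Rightarrow> ('v \<Rightarrow> nat) \<Rightarrow> ('v, 'k::comm_ring_1) mpoly set" where
  "edge_ideal E w = ideal_gen {Var i * Var j ^ w j | i j. (i, j) \<in> E}"

definition induced_cycle :: "('v \<Rightarrow> 'v \<Rightarrow> bool) \<Rightarrow> 'v list \<Rightarrow> bool" where
  "induced_cycle adj cs \<longleftrightarrow> length cs \<ge> 3 \<and> distinct cs \<and>
     (\<forall>i < length cs. \<forall>j < length cs.
        adj (cs ! i) (cs ! j) \<longleftrightarrow> (j = (i + 1) mod length cs \<or> i = (j + 1) mod length cs))"

definition chordal :: "('v \<Rightarrow> 'v \<Rightarrow> bool) \<Rightarrow> bool" where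
  "chordal adj \<longleftrightarrow> (\<forall>cs. induced_cycle adj cs \<longrightarrow> length cs < 4)"

end

theory Submission
  imports Defs "HOL-Library.FuncSet"
begin

text \<open>Let \<open>J\<close> be the dual of the edge ideal and \<open>n\<close> the number of vertices. Every edge \<open>(p, q)\<close> gives
  \<open>J \<subseteq> (x\<^sub>p, x\<^sub>q)\<close>, so \<open>dim R/J \<ge> n - 2\<close>, and Cohen-Macaulayness yields a regular sequence of length
  \<open>n - 2\<close>. Hence for all exponents \<open>W\<close> the Koszul homology of the powers \<open>x\<^sub>i ^ W i\<close> with coefficients
  in \<open>R/J\<close> vanishes in degree 3. Suppose the complement has an induced cycle of length at least 4.
  For suitable \<open>W\<close> and in a suitable multidegree this Koszul complex is the chain complex of the full
  simplex on the vertices of the cycle relative to the cycle itself, whose second homology is nonzero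
  (the Koszul degree is the number of vertices of a face). Using powers of the variables instead of
  the variables copes with the weights, and also makes localization at the variables of the cycle
  unnecessary.\<close>

subsection \<open>Ideals\<close>

lemma is_ideal_ideal_gen: "is_ideal (ideal_gen S)"
  unfolding ideal_gen_def is_ideal_def by auto

lemma ideal_gen_superset: "S \<subseteq> ideal_gen S"
  unfolding ideal_gen_def by blast

lemma ideal_gen_least: "is_ideal I \<Longrightarrow> S \<subseteq> I \<Longrightarrow> ideal_gen S \<subseteq> I"
  unfolding ideal_gen_def by blast

lemma ideal_zero: "is_ideal I \<Longrightarrow> 0 \<in> I"
  by (simp add: is_ideal_def)

lemma ideal_add: "is_ideal I \<Longrightarrow> a \<in> I \<Longrightarrow> b \<in> I \<Longrightarrow> a + b \<in> I"
  by (simp add: is_ideal_def)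

lemma ideal_mult: "is_ideal I \<Longrightarrow> a \<in> I \<Longrightarrow> r * a \<in> I"
  by (simp add: is_ideal_def)

lemma ideal_diff: "is_ideal I \<Longrightarrow> a \<in> I \<Longrightarrow> b \<in> I \<Longrightarrow> a - b \<in> I"
  using ideal_add[of I a "- b"] ideal_mult[of I b "- 1"] by simp

lemma ideal_sum: "is_ideal I \<Longrightarrow> (\<And>x. x \<in> A \<Longrightarrow> f x \<in> I) \<Longrightarrow> sum f A \<in> I"
  by (induction A rule: infinite_finite_induct) (auto intro: ideal_zero ideal_add)

text \<open>The sums \<open>a + f * r\<close> already form an ideal containing
  \<open>insert f S\<close>. This form lets a congruence modulo \<open>f\<close> be lifted to an
  equation modulo \<open>S\<close>.\<close>

lemma ideal_gen_insert:
  assumes "p \<in> ideal_gen (insert f S)"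
  obtains a r where "a \<in> ideal_gen S" "p = a + f * r"
proof -
  let ?I = "{a + f * r | a r. a \<in> ideal_gen S}"
  note S = is_ideal_ideal_gen[of S]
  have "is_ideal ?I"
    unfolding is_ideal_def
  proof (intro conjI ballI allI)
    show "0 \<in> ?I"
      using ideal_zero[OF S] by (metis (mono_tags, lifting) CollectI add.right_neutral mult_zero_right)
  next
    fix x y assume "x \<in> ?I" "y \<in> ?I"
    then obtain a r b s where "a \<in> ideal_gen S" "b \<in> ideal_gen S" "x = a + f * r" "y = b + f * s"
      by blast
    then have "x + y = (a + b) + f * (r + s)" "a + b \<in> ideal_gen S"
      by (auto simp: algebra_simps intro: ideal_add[OF S])
    then show "x + y \<in> ?I" by blast
  next
    fix t x assume "x \<in> ?I"
    then obtain a r where "a \<in> ideal_gen S" "x = a + f * r" by blast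
    then have "t * x = t * a + f * (t * r)" "t * a \<in> ideal_gen S"
      by (simp add: algebra_simps) (rule ideal_mult[OF S], fact)
    then show "t * x \<in> ?I" by blast
  qed
  moreover have "insert f S \<subseteq> ?I"
  proof
    fix x assume "x \<in> insert f S"
    then show "x \<in> ?I"
    proof
      assume "x = f"
      then have "x = 0 + f * 1" by simp
      then show ?thesis using ideal_zero[OF S] by blast
    next
      assume "x \<in> S"
      then have "x = x + f * 0" "x \<in> ideal_gen S" using ideal_gen_superset[of S] by auto
      then show ?thesis by blast
    qed
  qed
  ultimately have "p \<in> ?I" using ideal_gen_least assms by blast
  then show thesis using that by blast
qed

lemma ideal_gen_insert_gen: "f * r \<in> ideal_gen (insert f S)"
proof -
  have "f \<in> ideal_gen (insert f S)" using ideal_gen_superset[of "insert f S"] by blast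
  then show ?thesis using ideal_mult[OF is_ideal_ideal_gen, of f _ r] by (simp add: mult.commute)
qed

lemma ideal_gen_mono: "S \<subseteq> T \<Longrightarrow> ideal_gen S \<subseteq> ideal_gen T"
  unfolding ideal_gen_def by blast

subsection \<open>Monomial ideals\<close>

abbreviation "lookup \<equiv> Poly_Mapping.lookup"
abbreviation "keys \<equiv> Poly_Mapping.keys"
abbreviation "single \<equiv> Poly_Mapping.single"
abbreviation expo :: "('v::finite \<Rightarrow> nat) \<Rightarrow> 'v \<Rightarrow>\<^sub>0 nat" where
  "expo \<equiv> Abs_poly_mapping"

lemma expo_lookup [simp]: "expo (lookup k) = k"
  by (rule poly_mapping_eqI) simp

lemma expo_add: "expo (\<lambda>i. a i + b i) = expo a + expo b"
  by (rule poly_mapping_eqI) (simp add: lookup_add)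

lemma le_lookup_split:
  assumes "e \<le> lookup (k :: 'v::finite \<Rightarrow>\<^sub>0 nat)"
  obtains l where "k = expo e + l"
proof
  show "k = expo e + expo (\<lambda>i. lookup k i - e i)"
    by (rule poly_mapping_eqI) (use assms in \<open>simp add: lookup_add le_fun_def\<close>)
qed

lemma poly_sum_monomials: "p = (\<Sum>a\<in>keys p. single a (lookup p a))"
  by (rule poly_mapping_eqI)
    (simp add: lookup_sum lookup_single when_def in_keys_iff)

lemma lookup_times:
  fixes p q :: "('a::comm_monoid_add) \<Rightarrow>\<^sub>0 ('k::comm_semiring_0)"
  shows "lookup (p * q) m =
    (\<Sum>a\<in>keys p. \<Sum>b\<in>keys q. if a + b = m then lookup p a * lookup q b else 0)"
proof -
  have "p * q = (\<Sum>a\<in>keys p. single a (lookup p a)) * (\<Sum>b\<in>keys q. single b (lookup q b))"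
    using poly_sum_monomials[of p] poly_sum_monomials[of q] by simp
  also have "\<dots> = (\<Sum>a\<in>keys p. \<Sum>b\<in>keys q. single (a + b) (lookup p a * lookup q b))"
    by (simp add: sum_product mult_single)
  finally show ?thesis
    by (simp add: lookup_sum lookup_single when_def)
qed

lemma lookup_monom_times:
  "lookup (monom e * p :: ('v::finite, 'k::comm_ring_1) mpoly) m =
    (if e \<le> lookup m then lookup p (expo (\<lambda>i. lookup m i - e i)) else 0)"
\<comment> \<open>Over the zero ring all coefficients agree; otherwise \<open>expo e\<close> is the
  only key of \<open>monom e\<close>.\<close>
proof (cases "(1::'k) = 0")
  case True
  then have "a = (b::'k)" for a b by (metis mult_1 mult_zero_left)
  then show ?thesis by blast
next
  case False
  let ?d = "expo (\<lambda>i. lookup m i - e i)"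
  have "lookup (monom e * p) m = (\<Sum>b\<in>keys p. if expo e + b = m then lookup p b else 0)"
    using False by (simp add: lookup_times monom_def if_distrib cong: if_cong)
  also have "\<dots> = (if e \<le> lookup m then lookup p ?d else 0)"
  proof (cases "e \<le> lookup m")
    case True
    then have "expo e + ?d = m"
      by (intro poly_mapping_eqI) (simp add: lookup_add le_fun_def)
    then have "expo e + b = m \<longleftrightarrow> b = ?d" for b by (metis add_left_cancel)
    then show ?thesis using True by (simp add: in_keys_iff)
  next
    case False
    have "expo e + b \<noteq> m" for b
    proof
      assume "expo e + b = m"
      then have "lookup m = (\<lambda>i. e i + lookup b i)" by (auto simp: lookup_add)
      then show False using False by (simp add: le_fun_def)
    qed
    then show ?thesis using False by simp
  qed
  finally show ?thesis .
qed

text \<open>Divisibility of every term by a generator survives sums and multiples, and conversely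
  each such term is a multiple of a generator. This reduces membership to comparing
  exponents.\<close>

lemma mem_ideal_gen_monom:
  fixes p :: "('v::finite, 'k::comm_ring_1) mpoly"
  shows "p \<in> ideal_gen (monom ` G) \<longleftrightarrow> (\<forall>k\<in>keys p. \<exists>e\<in>G. e \<le> lookup k)"
proof
  let ?I = "{p :: ('v, 'k) mpoly. \<forall>k\<in>keys p. \<exists>e\<in>G. e \<le> lookup k}"
  have "is_ideal ?I"
    unfolding is_ideal_def
  proof (intro conjI ballI allI)
    fix x y assume "x \<in> ?I" "y \<in> ?I"
    then show "x + y \<in> ?I" using Poly_Mapping.keys_add[of x y] by blast
  next
    fix r x assume x: "x \<in> ?I"
    have "\<exists>e\<in>G. e \<le> lookup k" if "k \<in> keys (r * x)" for k
    proof -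
      from that keys_mult[of r x] have "k \<in> {a + b |a b. a \<in> keys r \<and> b \<in> keys x}" by blast
      then obtain a b where "k = a + b" "b \<in> keys x" by blast
      moreover from this x obtain e where "e \<in> G" "e \<le> lookup b" by blast
      ultimately show ?thesis
        by (intro bexI[of _ e]) (auto simp: le_fun_def lookup_add intro: trans_le_add2)
    qed
    then show "r * x \<in> ?I" by blast
  qed simp
  moreover have "monom ` G \<subseteq> ?I"
    by (auto simp: monom_def)
  ultimately show "p \<in> ideal_gen (monom ` G) \<Longrightarrow> \<forall>k\<in>keys p. \<exists>e\<in>G. e \<le> lookup k"
    using ideal_gen_least by blast
next
  assume p: "\<forall>k\<in>keys p. \<exists>e\<in>G. e \<le> lookup k"
  have "single k (lookup p k) \<in> ideal_gen (monom ` G)" if k: "k \<in> keys p" for k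
  proof -
    obtain e where e: "e \<in> G" "e \<le> lookup k" using p k by blast
    then obtain l where "k = expo e + l" using le_lookup_split by blast
    then have "single k (lookup p k) = single l (lookup p k) * monom e"
      by (simp add: monom_def mult_single add.commute)
    moreover have "monom e \<in> ideal_gen (monom ` G)"
      using e ideal_gen_superset by blast
    ultimately show ?thesis using ideal_mult[OF is_ideal_ideal_gen] by metis
  qed
  then show "p \<in> ideal_gen (monom ` G)"
    by (subst poly_sum_monomials) (rule ideal_sum[OF is_ideal_ideal_gen])
qed

lemma keys_monom: "keys (monom e :: ('v::finite, 'k::field) mpoly) = {expo e}"
  by (simp add: monom_def)

lemma monom_mem_ideal_gen_monom:
  "(monom a :: ('v::finite, 'k::field) mpoly) \<in> ideal_gen (monom ` G) \<longleftrightarrow> (\<exists>e\<in>G. e \<le> a)"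
  by (simp add: mem_ideal_gen_monom keys_monom)

lemma monom_mult: "monom a * monom b = monom (\<lambda>i. a i + b i)"
  by (simp add: monom_def mult_single expo_add)

lemma Var_power: "(Var i :: ('v::finite, 'k::comm_ring_1) mpoly) ^ n = monom (\<lambda>j. if j = i then n else 0)"
proof (induction n)
  case 0
  then show ?case by (simp add: monom_def)
next
  case (Suc n)
  have V: "(Var i :: ('v, 'k) mpoly) = monom (\<lambda>j. if j = i then 1 else 0)"
    unfolding Var_def monom_def
    by (rule arg_cong[where f = "\<lambda>m. single m 1"], rule poly_mapping_eqI)
      (simp add: lookup_single when_def)
  have "(Var i :: ('v, 'k) mpoly) ^ Suc n = monom (\<lambda>j. (if j = i then 1 else 0) + (if j = i then n else 0))"
    by (subst power_Suc, subst Suc, subst V, rule monom_mult)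
  also have "(\<lambda>j. (if j = i then 1 else 0) + (if j = i then n else 0)) = (\<lambda>j. if j = i then Suc n else 0)"
    by auto
  finally show ?case .
qed

subsection \<open>Krull dimension\<close>

text \<open>The ideal generated by the variables indexed by \<open>A\<close>, given through supports
  so that membership is read off the exponents.\<close>

definition var_prime :: "'v set \<Rightarrow> ('v, 'k::comm_ring_1) mpoly set" where
  "var_prime A = {p. \<forall>k\<in>keys p. \<exists>i\<in>A. lookup k i \<noteq> 0}"

text \<open>Relabelling the variables by natural numbers makes the library's lexicographic order on
  monomials available; the product of the leading terms avoiding \<open>A\<close> cannot cancel.\<close>

lemma is_prime_ideal_var_prime:
  "is_prime_ideal (var_prime A :: ('v::finite, 'k::field) mpoly set)"
proof -
  let ?P = "var_prime A :: ('v, 'k) mpoly set"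
  have "?P = ideal_gen (monom ` {e. \<exists>i\<in>A. e i \<noteq> 0})"
  proof (intro set_eqI)
    fix p :: "('v, 'k) mpoly"
    have "(\<exists>i\<in>A. lookup k i \<noteq> 0) \<longleftrightarrow> (\<exists>e\<in>{e. \<exists>i\<in>A. e i \<noteq> 0}. e \<le> lookup k)"
      for k :: "'v \<Rightarrow>\<^sub>0 nat"
    proof
      assume "\<exists>e\<in>{e. \<exists>i\<in>A. e i \<noteq> 0}. e \<le> lookup k"
      then obtain e i where "i \<in> A" "e i \<noteq> 0" "e \<le> lookup k" by blast
      then show "\<exists>i\<in>A. lookup k i \<noteq> 0" using le_funD[of e "lookup k" i] by (intro bexI[of _ i]) auto
    qed (intro bexI[of _ "lookup k"], auto)
    then show "p \<in> ?P \<longleftrightarrow> p \<in> ideal_gen (monom ` {e. \<exists>i\<in>A. e i \<noteq> 0})"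
      by (simp add: mem_ideal_gen_monom var_prime_def)
  qed
  then have ideal: "is_ideal ?P" by (simp add: is_ideal_ideal_gen)
  obtain num :: "'v \<Rightarrow> nat" where num: "inj num"
    using finite_imp_inj_to_nat_seg[OF finite_UNIV] by blast
  define ren :: "('v \<Rightarrow>\<^sub>0 nat) \<Rightarrow> nat \<Rightarrow>\<^sub>0 nat"
    where "ren k = (\<Sum>i\<in>UNIV. single (num i) (lookup k i))" for k
  have ren_add: "ren (k + l) = ren k + ren l" for k l
    by (simp add: ren_def lookup_add single_add sum.distrib)
  have "lookup (ren k) (num i) = lookup k i" for k i
    using num by (simp add: ren_def lookup_sum lookup_single when_def inj_eq)
  then have ren_inj: "ren k = ren l \<Longrightarrow> k = l" for k l
    by (metis poly_mapping_eqI)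
  define van where "van k \<longleftrightarrow> (\<forall>i\<in>A. lookup k i = 0)" for k :: "'v \<Rightarrow>\<^sub>0 nat"
  have van_add: "van (k + l) \<longleftrightarrow> van k \<and> van l" for k l
    by (auto simp: van_def lookup_add)
  have lead: "\<exists>k\<in>keys p. van k \<and> (\<forall>l\<in>keys p. van l \<longrightarrow> ren l \<le> ren k)" if "p \<notin> ?P" for p
  proof -
    let ?K = "{k\<in>keys p. van k}"
    have "finite (ren ` ?K)" "ren ` ?K \<noteq> {}"
      using that by (auto simp: var_prime_def van_def)
    then have "Max (ren ` ?K) \<in> ren ` ?K" and max: "\<And>x. x \<in> ren ` ?K \<Longrightarrow> x \<le> Max (ren ` ?K)"
      by (auto simp del: Max_ge_iff)
    then obtain k where "k \<in> ?K" "Max (ren ` ?K) = ren k" by blast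
    then show ?thesis using max by (intro bexI[of _ k]) auto
  qed
  have "p * q \<notin> ?P" if p: "p \<notin> ?P" and q: "q \<notin> ?P" for p q
  proof -
    obtain k where k: "k \<in> keys p" "van k" "\<And>l. l \<in> keys p \<Longrightarrow> van l \<Longrightarrow> ren l \<le> ren k"
      using lead[OF p] by blast
    obtain l where l: "l \<in> keys q" "van l" "\<And>m. m \<in> keys q \<Longrightarrow> van m \<Longrightarrow> ren m \<le> ren l"
      using lead[OF q] by blast
    \<comment> \<open>A product avoids \<open>A\<close> only if both factors do, so \<open>a\<close>
      and \<open>b\<close> compete with the leading terms. Their images under \<open>ren\<close>
      have the same sum, so neither can be strictly smaller.\<close>
    have uniq: "a = k \<and> b = l" if "a \<in> keys p" "b \<in> keys q" "a + b = k + l" for a b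
    proof -
      have "van a" "van b" using that(3) van_add k(2) l(2) by metis+
      then have "ren a \<le> ren k" "ren b \<le> ren l" using that k(3) l(3) by auto
      moreover have "ren a + ren b = ren k + ren l" using that(3) ren_add by metis
      ultimately have "ren a = ren k"
        by (metis add_less_le_mono less_irrefl order_le_less)
      then have "a = k" by (rule ren_inj)
      then show ?thesis using that(3) by simp
    qed
    have "lookup (p * q) (k + l) =
        (\<Sum>a\<in>keys p. \<Sum>b\<in>keys q. if a = k \<and> b = l then lookup p a * lookup q b else 0)"
      unfolding lookup_times by (intro sum.cong refl) (use uniq in auto)
    also have "\<dots> = (\<Sum>a\<in>keys p. if a = k then lookup p k * lookup q l else 0)"
    proof (rule sum.cong[OF refl])
      fix a
      show "(\<Sum>b\<in>keys q. if a = k \<and> b = l then lookup p a * lookup q b else 0)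
          = (if a = k then lookup p k * lookup q l else 0)"
        using l(1) by (cases "a = k") auto
    qed
    also have "\<dots> = lookup p k * lookup q l" using k(1) by simp
    finally have "k + l \<in> keys (p * q)" using k(1) l(1) by (simp add: in_keys_iff)
    moreover have "van (k + l)" using van_add k(2) l(2) by blast
    ultimately show ?thesis by (auto simp: var_prime_def van_def)
  qed
  moreover have "1 \<notin> ?P" by (simp add: var_prime_def)
  ultimately show ?thesis unfolding is_prime_ideal_def using ideal by blast
qed

lemma var_prime_strict_mono:
  assumes "A \<subseteq> B" "i \<in> B - A"
  shows "(var_prime A :: ('v::finite, 'k::field) mpoly set) \<subset> var_prime B"
proof -
  have "(Var i :: ('v, 'k) mpoly) \<in> var_prime B - var_prime A"
    using assms(2) by (auto simp: var_prime_def Var_def lookup_single when_def)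
  moreover have "(var_prime A :: ('v, 'k) mpoly set) \<subseteq> var_prime B"
    using assms(1) unfolding var_prime_def by blast
  ultimately show ?thesis by blast
qed

text \<open>Adjoining the other variables one at a time to the prime of \<open>p\<close> and
  \<open>q\<close> gives a strict chain of \<open>n - 1\<close> primes over \<open>J\<close>, hence
  a chain of length \<open>n - 2\<close>, where \<open>n\<close> is the number of variables.\<close>

lemma krull_dim_quot_ge:
  fixes J :: "('v::finite, 'k::field) mpoly set"
  assumes "J \<subseteq> var_prime {p, q}" "p \<noteq> q"
  shows "enat (card (UNIV :: 'v set) - 2) \<le> krull_dim_quot J"
proof -
  obtain rest where rest: "set rest = UNIV - {p, q}" "distinct rest"
    using finite_distinct_list[of "UNIV - {p, q}"] by auto
  have len: "length rest = card (UNIV :: 'v set) - 2"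
    using distinct_card[OF rest(2)] rest(1) assms(2) by (simp add: card_Diff_subset)
  define P :: "nat \<Rightarrow> ('v, 'k) mpoly set" where "P k = var_prime ({p, q} \<union> set (take k rest))" for k
  let ?ps = "map P [0..<Suc (length rest)]"
  have "P k \<subset> P l" if "k < l" "l \<le> length rest" for k l
    unfolding P_def
  proof (rule var_prime_strict_mono)
    show "{p, q} \<union> set (take k rest) \<subseteq> {p, q} \<union> set (take l rest)"
      using set_take_subset_set_take[of k l rest] that by auto
    have "rest ! k \<notin> set (take k rest)"
      using that rest(2) by (auto simp: in_set_conv_nth nth_eq_iff_index_eq)
    moreover have "rest ! k \<in> set (take l rest)"
      using that by (auto simp: in_set_conv_nth intro!: exI[of _ k])
    moreover have "rest ! k \<notin> {p, q}" using rest(1) that nth_mem[of k rest] by auto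
    ultimately show "rest ! k \<in> ({p, q} \<union> set (take l rest)) - ({p, q} \<union> set (take k rest))"
      by blast
  qed
  then have "sorted_wrt (\<subset>) ?ps"
    unfolding sorted_wrt_map by (simp add: sorted_wrt_iff_nth_less del: upt_Suc)
  moreover have "is_prime_ideal (P k) \<and> J \<subseteq> P k" for k
  proof
    show "is_prime_ideal (P k)" unfolding P_def by (rule is_prime_ideal_var_prime)
    show "J \<subseteq> P k" using assms(1) unfolding P_def var_prime_def by blast
  qed
  ultimately have "enat (length ?ps - 1) \<le> krull_dim_quot J"
    unfolding krull_dim_quot_def by (intro SUP_upper) auto
  then show ?thesis by (simp add: len)
qed

subsection \<open>Koszul complexes\<close>

text \<open>The Koszul complex on a sequence \<open>X\<close> indexed by a finite type: a form assigns a coefficient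
  to each set of indices, which is read as the wedge product of its elements in increasing order
  of \<open>num\<close>. Forms of degree \<open>d\<close> are arbitrary functions of which only the values on
  \<open>d\<close>-element sets matter.\<close>

definition ksgn :: "('v \<Rightarrow> nat) \<Rightarrow> 'v \<Rightarrow> 'v set \<Rightarrow> 'r::comm_ring_1" where
  "ksgn num i S = (- 1) ^ card {s \<in> S. num s < num i}"

definition kbd :: "('v::finite \<Rightarrow> nat) \<Rightarrow> ('v \<Rightarrow> 'r::comm_ring_1) \<Rightarrow> ('v set \<Rightarrow> 'r) \<Rightarrow> 'v set \<Rightarrow> 'r" where
  "kbd num X z S = (\<Sum>i\<in>- S. ksgn num i S * X i * z (insert i S))"

text \<open>Left wedge multiplication by the one-form with coefficients \<open>g\<close>.\<close>

definition kwedge :: "('v::finite \<Rightarrow> nat) \<Rightarrow> ('v \<Rightarrow> 'r::comm_ring_1) \<Rightarrow> ('v set \<Rightarrow> 'r) \<Rightarrow> 'v set \<Rightarrow> 'r" where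
  "kwedge num g z S = (\<Sum>i\<in>S. ksgn num i (S - {i}) * g i * z (S - {i}))"

text \<open>Vanishing of Koszul homology in degree \<open>d\<close> with coefficients modulo
  \<open>I\<close>, phrased with lifts so that no quotient ring is formed. Writing
  \<open>card S + 1 = d\<close> leaves no cycle condition in degree 0.\<close>

definition kexact :: "('v::finite \<Rightarrow> nat) \<Rightarrow> ('v \<Rightarrow> 'r::comm_ring_1) \<Rightarrow> 'r set \<Rightarrow> nat \<Rightarrow> bool" where
  "kexact num X I d \<longleftrightarrow> (\<forall>z. (\<forall>S. card S + 1 = d \<longrightarrow> kbd num X z S \<in> I)
     \<longrightarrow> (\<exists>t. \<forall>S. card S = d \<longrightarrow> z S - kbd num X t S \<in> I))"

section \<open>Sign rules for reordering wedge factors\<close>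

lemma ksgn_insert:
  fixes S :: "'v::finite set"
  assumes "k \<notin> S"
  shows "ksgn num i (insert k S) = (if num k < num i then - 1 else 1) * ksgn num i S"
proof -
  have "{s \<in> insert k S. num s < num i} =
      (if num k < num i then insert k {s \<in> S. num s < num i} else {s \<in> S. num s < num i})"
    by auto
  then show ?thesis using assms by (simp add: ksgn_def)
qed

lemma ksgn_cases: "ksgn num i S = 1 \<or> ksgn num i S = - 1"
  unfolding ksgn_def by (simp add: minus_one_power_iff)

lemma ksgn_pair:
  fixes x y :: "'v::finite"
  assumes "num x \<noteq> num y"
  shows "ksgn num i {x, y} = (if num x < num i then - 1 else 1) * (if num y < num i then - 1 else 1)"
proof -
  have "x \<noteq> y" using assms by blast
  then have "ksgn num i {x, y} = (if num x < num i then - 1 else 1) * ((if num y < num i then - 1 else 1) * ksgn num i {})"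
    by (simp only: ksgn_insert insert_iff empty_iff simp_thms)
  then show ?thesis by (simp add: ksgn_def)
qed

lemma ksgn_square [simp]: "ksgn num i S * ksgn num i S = 1"
  by (simp add: ksgn_def flip: power_mult_distrib)

text \<open>Exactly one of \<open>i\<close> and \<open>k\<close> precedes the other, so exactly one
  of the two insertions changes a sign.\<close>

lemma ksgn_anticommute:
  fixes S :: "'v::finite set"
  assumes "inj num" "i \<noteq> k" "i \<notin> S" "k \<notin> S"
  shows "ksgn num i S * ksgn num k (insert i S) = - (ksgn num k S * ksgn num i (insert k S))"
proof -
  have "num i < num k \<and> \<not> num k < num i \<or> num k < num i \<and> \<not> num i < num k"
    using assms by (metis inj_eq linorder_neqE_nat less_asym)
  then show ?thesis using assms by (auto simp: ksgn_insert)
qed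

lemma ksgn_exchange:
  fixes S :: "'v::finite set"
  assumes "inj num" "i \<noteq> k" "i \<notin> S" "k \<notin> S"
  shows "ksgn num i (insert k S) * ksgn num k (insert i S) = - (ksgn num k S * ksgn num i S)"
proof -
  have "num i < num k \<and> \<not> num k < num i \<or> num k < num i \<and> \<not> num i < num k"
    using assms by (metis inj_eq linorder_neqE_nat less_asym)
  then show ?thesis using assms by (auto simp: ksgn_insert)
qed

section \<open>Algebra of the Koszul differential\<close>

lemma kbd_diff: "kbd num X (\<lambda>S. u S - v S) S = kbd num X u S - kbd num X v S"
  by (simp add: kbd_def sum_subtractf algebra_simps)

lemma kbd_add: "kbd num X (\<lambda>S. u S + v S) S = kbd num X u S + kbd num X v S"
  by (simp add: kbd_def sum.distrib algebra_simps)

lemma kbd_cmult: "kbd num X (\<lambda>S. f * v S) S = f * kbd num X v S"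
  by (simp add: kbd_def sum_distrib_left algebra_simps)

lemma kbd_cong: "(\<And>T. card T = card S + 1 \<Longrightarrow> u T = v T) \<Longrightarrow> kbd num X u S = kbd num X v S"
  unfolding kbd_def by (intro sum.cong) auto

lemma kbd_mem_ideal:
  "is_ideal I \<Longrightarrow> (\<And>T. card T = card S + 1 \<Longrightarrow> u T \<in> I) \<Longrightarrow> kbd num X u S \<in> I"
  unfolding kbd_def by (intro ideal_sum ideal_mult) auto

text \<open>Each pair with \<open>num i < num k\<close> cancels against its swap. Pairing terms,
  instead of showing that the sum equals its own negative, also covers characteristic 2.\<close>

lemma sum_antisymmetric_zero:
  fixes F :: "'v::finite \<Rightarrow> 'v \<Rightarrow> 'r::comm_ring_1" and num :: "'v \<Rightarrow> nat"
  assumes "inj num" "\<And>i k. i \<in> A \<Longrightarrow> k \<in> A \<Longrightarrow> i \<noteq> k \<Longrightarrow> F i k = - F k i"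
  shows "(\<Sum>i\<in>A. \<Sum>k\<in>A - {i}. F i k) = 0"
proof -
  let ?L = "{(i, k). i \<in> A \<and> k \<in> A \<and> num i < num k}"
  let ?G = "{(i, k). i \<in> A \<and> k \<in> A \<and> num k < num i}"
  have eq: "Sigma A (\<lambda>i. A - {i}) = ?L \<union> ?G"
    using assms(1) by (auto simp: inj_eq) (metis inj_eq linorder_neqE_nat)
  have "(\<Sum>i\<in>A. \<Sum>k\<in>A - {i}. F i k) = (\<Sum>(i, k)\<in>Sigma A (\<lambda>i. A - {i}). F i k)"
    by (simp add: sum.Sigma)
  also have "\<dots> = (\<Sum>(i, k)\<in>?L. F i k) + (\<Sum>(i, k)\<in>?G. F i k)"
    unfolding eq by (rule sum.union_disjoint) auto
  also have "(\<Sum>(i, k)\<in>?G. F i k) = (\<Sum>(i, k)\<in>?L. F k i)"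
    by (rule sum.reindex_bij_witness[of _ prod.swap prod.swap]) auto
  also have "(\<Sum>(i, k)\<in>?L. F k i) = (\<Sum>(i, k)\<in>?L. - F i k)"
    using assms(2) by (intro sum.cong) auto
  also have "\<dots> = - (\<Sum>(i, k)\<in>?L. F i k)" by (simp add: sum_negf split_def)
  finally show ?thesis by simp
qed

lemma kbd_kbd:
  fixes X :: "'v::finite \<Rightarrow> 'r::comm_ring_1"
  assumes "inj num"
  shows "kbd num X (kbd num X z) S = 0"
proof -
  define F where "F i k = ksgn num i S * ksgn num k (insert i S) * (X i * X k * z (insert i (insert k S)))" for i k
  have "kbd num X (kbd num X z) S = (\<Sum>i\<in>- S. \<Sum>k\<in>- S - {i}. F i k)"
    unfolding kbd_def F_def
    by (intro sum.cong refl) (auto simp: sum_distrib_left insert_commute algebra_simps intro!: sum.cong)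
  also have "\<dots> = 0"
  proof (rule sum_antisymmetric_zero[OF assms])
    fix i k assume ik: "i \<in> - S" "k \<in> - S" "i \<noteq> k"
    then have "ksgn num i S * ksgn num k (insert i S) = - (ksgn num k S * ksgn num i (insert k S) :: 'r)"
      using ksgn_anticommute[OF assms] by simp
    then show "F i k = - F k i" unfolding F_def by (simp add: insert_commute mult.commute)
  qed
  finally show ?thesis .
qed

text \<open>The differential is contraction with \<open>X\<close>, an antiderivation: the diagonal
  terms add up to the pairing of \<open>g\<close> with \<open>X\<close>, and the mixed terms occur
  twice with opposite signs.\<close>

lemma kbd_kwedge:
  fixes X :: "'v::finite \<Rightarrow> 'r::comm_ring_1"
  assumes "inj num"
  shows "kbd num X (kwedge num g z) S + kwedge num g (kbd num X z) S = (\<Sum>i\<in>UNIV. g i * X i) * z S"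
proof -
  define F where "F i k = ksgn num k (S - {k}) * ksgn num i (S - {k}) *
    (X i * g k * z (insert i (S - {k})))" for i k
  have 1: "ksgn num i S * X i * kwedge num g z (insert i S)
      = g i * X i * z S - (\<Sum>k\<in>S. F i k)" if i: "i \<notin> S" for i
  proof -
    have "ksgn num i S * X i * kwedge num g z (insert i S) =
      ksgn num i S * X i * (ksgn num i S * g i * z S) +
      ksgn num i S * X i * (\<Sum>k\<in>S. ksgn num k (insert i S - {k}) * g k * z (insert i S - {k}))"
      unfolding kwedge_def using i by (simp add: algebra_simps)
    also have "ksgn num i S * X i * (ksgn num i S * g i * z S) = (ksgn num i S * ksgn num i S) * (g i * X i * z S)"
      by (simp only: ac_simps)
    also have "\<dots> = g i * X i * z S" by simp
    also have "ksgn num i S * X i * (\<Sum>k\<in>S. ksgn num k (insert i S - {k}) * g k * z (insert i S - {k}))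
       = (\<Sum>k\<in>S. - F i k)"
      unfolding sum_distrib_left
    proof (rule sum.cong[OF refl])
      fix k assume k: "k \<in> S"
      then have ki: "insert i S - {k} = insert i (S - {k})" "i \<noteq> k" "insert k (S - {k}) = S" using i by auto
      then have sg: "ksgn num i S * ksgn num k (insert i (S - {k})) = - (ksgn num k (S - {k}) * ksgn num i (S - {k}) :: 'r)"
        using ksgn_exchange[OF assms, of i k "S - {k}"] i by simp
      have "ksgn num i S * X i * (ksgn num k (insert i (S - {k})) * g k * z (insert i (S - {k}))) =
        (ksgn num i S * ksgn num k (insert i (S - {k}))) * (X i * g k * z (insert i (S - {k})))"
        by (simp only: ac_simps)
      then show "ksgn num i S * X i * (ksgn num k (insert i S - {k}) * g k * z (insert i S - {k})) = - F i k"
        unfolding ki(1) F_def sg by simp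
    qed
    finally show ?thesis by (simp add: sum_negf)
  qed
  have 2: "ksgn num k (S - {k}) * g k * kbd num X z (S - {k}) = g k * X k * z S + (\<Sum>i\<in>- S. F i k)"
    if k: "k \<in> S" for k
  proof -
    have "- (S - {k}) = insert k (- S)" and ins: "insert k (S - {k}) = S" using k by auto
    then have "kbd num X z (S - {k}) = ksgn num k (S - {k}) * X k * z S +
        (\<Sum>i\<in>- S. ksgn num i (S - {k}) * X i * z (insert i (S - {k})))"
      using k by (simp add: kbd_def)
    moreover have "ksgn num k (S - {k}) * g k * (\<Sum>i\<in>- S. ksgn num i (S - {k}) * X i * z (insert i (S - {k})))
        = (\<Sum>i\<in>- S. F i k)"
      unfolding sum_distrib_left F_def by (intro sum.cong refl) (simp only: ac_simps)
    moreover have "ksgn num k (S - {k}) * g k * (ksgn num k (S - {k}) * X k * z S) =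
        (ksgn num k (S - {k}) * ksgn num k (S - {k})) * (g k * X k * z S)"
      by (simp only: ac_simps)
    ultimately have "ksgn num k (S - {k}) * g k * kbd num X z (S - {k}) =
      (ksgn num k (S - {k}) * ksgn num k (S - {k})) * (g k * X k * z S) + (\<Sum>i\<in>- S. F i k)"
      by (simp only: distrib_left)
    then show ?thesis by simp
  qed
  have "kbd num X (kwedge num g z) S = (\<Sum>i\<in>- S. g i * X i * z S) - (\<Sum>i\<in>- S. \<Sum>k\<in>S. F i k)"
    unfolding kbd_def by (simp add: 1 sum_subtractf)
  moreover have "kwedge num g (kbd num X z) S = (\<Sum>i\<in>S. g i * X i * z S) + (\<Sum>k\<in>S. \<Sum>i\<in>- S. F i k)"
    unfolding kwedge_def[of num g "kbd num X z"] by (simp add: 2 sum.distrib)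
  moreover have "(\<Sum>k\<in>S. \<Sum>i\<in>- S. F i k) = (\<Sum>i\<in>- S. \<Sum>k\<in>S. F i k)" by (rule sum.swap)
  moreover have "(\<Sum>i\<in>- S. g i * X i * z S) + (\<Sum>i\<in>S. g i * X i * z S) = (\<Sum>i\<in>UNIV. g i * X i * z S)"
    using sum.subset_diff[of S UNIV "\<lambda>i. g i * X i * z S"] by (simp add: Compl_eq_Diff_UNIV)
  ultimately show ?thesis unfolding sum_distrib_right by (smt (verit, ccfv_threshold) add.commute add.left_commute diff_add_cancel)
qed

section \<open>Regular sequences and vanishing of Koszul homology\<close>

text \<open>On Koszul homology with coefficients in \<open>R/I\<close>, multiplication by \<open>f\<close> is injective in degree
  \<open>d\<close> by the long exact sequence, and nilpotent because the Koszul differential and the wedge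
  product with \<open>g\<close> give a homotopy from multiplication by \<open>f ^ N\<close> to zero.\<close>

lemma kexact_regular_element:
  fixes X :: "'v::finite \<Rightarrow> 'r::comm_ring_1"
  assumes num: "inj num" and S: "I = ideal_gen A"
    and reg: "\<And>g. f * g \<in> I \<Longrightarrow> g \<in> I"
    and exact: "kexact num X (ideal_gen (insert f A)) (Suc d)"
    and nilp: "f ^ N = (\<Sum>i\<in>UNIV. g i * X i)"
  shows "kexact num X I d"
  unfolding kexact_def
proof (intro allI impI)
  fix z assume cyc: "\<forall>S. card S + 1 = d \<longrightarrow> kbd num X z S \<in> I"
  have I: "is_ideal I" unfolding S by (rule is_ideal_ideal_gen)
  have I_sub: "I \<subseteq> ideal_gen (insert f A)" unfolding S by (rule ideal_gen_mono) blast
  define bdry where "bdry z \<longleftrightarrow> (\<exists>t. \<forall>S. card S = d \<longrightarrow> z S - kbd num X t S \<in> I)" for z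
  \<comment> \<open>If \<open>f * z\<close> is the boundary of \<open>u\<close> modulo
    \<open>I\<close>, then \<open>u\<close> is a cycle modulo \<open>f\<close>. Exactness one degree
    higher writes \<open>u\<close> as a boundary plus \<open>a + f * t\<close> with \<open>a\<close>
    in \<open>I\<close>; taking boundaries and cancelling the regular \<open>f\<close> makes
    \<open>z\<close> the boundary of \<open>t\<close>.\<close>
  have step: "bdry z" if "bdry (\<lambda>S. f * z S)" for z
  proof -
    from that obtain u where u: "\<And>S. card S = d \<Longrightarrow> f * z S - kbd num X u S \<in> I"
      unfolding bdry_def by blast
    have "kbd num X u S \<in> ideal_gen (insert f A)" if "card S + 1 = Suc d" for S
    proof -
      have "f * z S - kbd num X u S \<in> ideal_gen (insert f A)"
        using u[of S] that I_sub by auto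
      from ideal_diff[OF is_ideal_ideal_gen ideal_gen_insert_gen[of f "z S"] this] show ?thesis by simp
    qed
    then obtain v where v: "\<And>S. card S = Suc d \<Longrightarrow> u S - kbd num X v S \<in> ideal_gen (insert f A)"
      using exact unfolding kexact_def by blast
    have "\<exists>ab. card S = Suc d \<longrightarrow> fst ab \<in> I \<and> u S - kbd num X v S = fst ab + f * snd ab" for S
    proof (cases "card S = Suc d")
      case True
      obtain a t where "a \<in> ideal_gen A" "u S - kbd num X v S = a + f * t"
        by (rule ideal_gen_insert[OF v[OF True]])
      then show ?thesis using S by (intro exI[of _ "(a, t)"]) simp
    qed simp
    then obtain ab where
      "\<forall>S. card S = Suc d \<longrightarrow> fst (ab S) \<in> I \<and> u S - kbd num X v S = fst (ab S) + f * snd (ab S)"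
      using choice[of "\<lambda>S ab. card S = Suc d \<longrightarrow> fst ab \<in> I \<and> u S - kbd num X v S = fst ab + f * snd ab"]
      by blast
    then obtain a t where at: "\<And>S. card S = Suc d \<Longrightarrow> a S \<in> I \<and> u S - kbd num X v S = a S + f * t S"
      by (intro that[of "\<lambda>S. fst (ab S)" "\<lambda>S. snd (ab S)"]) blast
    have "z S - kbd num X t S \<in> I" if S: "card S = d" for S
    proof (rule reg)
      have "kbd num X u S = kbd num X (\<lambda>S. u S - kbd num X v S) S"
        by (simp add: kbd_diff kbd_kbd[OF num])
      also have "\<dots> = kbd num X (\<lambda>S. a S + f * t S) S"
        by (rule kbd_cong) (use S at in auto)
      finally have "kbd num X u S = kbd num X a S + f * kbd num X t S"
        by (simp add: kbd_add kbd_cmult)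
      then have "f * (z S - kbd num X t S) = (f * z S - kbd num X u S) + kbd num X a S"
        by (simp add: algebra_simps)
      moreover have "kbd num X a S \<in> I"
        by (rule kbd_mem_ideal[OF I]) (use S at in auto)
      ultimately show "f * (z S - kbd num X t S) \<in> I"
        using u[OF S] ideal_add[OF I] by metis
    qed
    then show ?thesis unfolding bdry_def by blast
  qed
  \<comment> \<open>The homotopy formula applies: the wedge of \<open>g\<close> with the boundary of
    \<open>z\<close> lies in \<open>I\<close> because \<open>z\<close> is a cycle modulo
    \<open>I\<close>.\<close>
  have "bdry (\<lambda>S. f ^ N * z S)"
    unfolding bdry_def
  proof (intro exI allI impI)
    fix S :: "'v set" assume S: "card S = d"
    have "f ^ N * z S - kbd num X (kwedge num g z) S = kwedge num g (kbd num X z) S"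
      using kbd_kwedge[OF num, of X g z S] nilp by (simp add: algebra_simps)
    moreover have "kwedge num g (kbd num X z) S \<in> I"
      unfolding kwedge_def
    proof (intro ideal_sum ideal_mult I)
      fix i assume "i \<in> S"
      then have "card (S - {i}) + 1 = d" using S by (metis Suc_eq_plus1 card_Suc_Diff1 finite)
      then show "kbd num X z (S - {i}) \<in> I" using cyc by blast
    qed
    ultimately show "f ^ N * z S - kbd num X (kwedge num g z) S \<in> I" by simp
  qed
  moreover have "bdry (\<lambda>S. f ^ M * z S) \<Longrightarrow> bdry z" for M
  proof (induction M)
    case (Suc M)
    then show ?case using step[of "\<lambda>S. f ^ M * z S"] by (simp add: mult.assoc)
  qed simp
  ultimately show "\<exists>t. \<forall>S. card S = d \<longrightarrow> z S - kbd num X t S \<in> I"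
    unfolding bdry_def by blast
qed

text \<open>All terms of \<open>f ^ N\<close> have degree at least \<open>N\<close>; once
  \<open>N\<close> exceeds the sum of the \<open>W i\<close>, some exponent must exceed its
  \<open>W i\<close>.\<close>

lemma max_ideal_nilpotent:
  fixes f :: "('v::finite, 'k::comm_ring_1) mpoly" and W :: "'v \<Rightarrow> nat"
  assumes "f \<in> max_ideal"
  obtains N g where "f ^ N = (\<Sum>i\<in>UNIV. g i * Var i ^ W i)"
proof -
  define deg :: "('v \<Rightarrow>\<^sub>0 nat) \<Rightarrow> nat" where "deg k = (\<Sum>i\<in>UNIV. lookup k i)" for k
  have deg_add: "deg (k + l) = deg k + deg l" for k l
    by (simp add: deg_def lookup_add sum.distrib)
  have high: "\<forall>k\<in>keys (f ^ N). N \<le> deg k" for N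
  proof (induction N)
    case (Suc N)
    show ?case
    proof
      fix k assume "k \<in> keys (f ^ Suc N)"
      then have "k \<in> {a + b |a b. a \<in> keys f \<and> b \<in> keys (f ^ N)}"
        using keys_mult[of f "f ^ N"] by auto
      then obtain a b where ab: "k = a + b" "a \<in> keys f" "b \<in> keys (f ^ N)" by blast
      have "a \<noteq> 0" using ab(2) assms by (auto simp: max_ideal_def in_keys_iff)
      then obtain i where "lookup a i \<noteq> 0" by (metis lookup_zero poly_mapping_eqI)
      then have "deg a \<noteq> 0" by (auto simp: deg_def)
      then show "Suc N \<le> deg k" using Suc ab deg_add by force
    qed
  qed simp
  let ?I = "{p :: ('v, 'k) mpoly. \<exists>g. p = (\<Sum>i\<in>UNIV. g i * Var i ^ W i)}"
  have "is_ideal ?I"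
    unfolding is_ideal_def
  proof (intro conjI ballI allI)
    show "0 \<in> ?I" by (auto intro: exI[of _ "\<lambda>_. 0"])
  next
    fix x y assume "x \<in> ?I" "y \<in> ?I"
    then obtain g h where "x = (\<Sum>i\<in>UNIV. g i * Var i ^ W i)" "y = (\<Sum>i\<in>UNIV. h i * Var i ^ W i)"
      by blast
    then have "x + y = (\<Sum>i\<in>UNIV. (g i + h i) * Var i ^ W i)"
      by (simp add: sum.distrib distrib_right)
    then show "x + y \<in> ?I" unfolding mem_Collect_eq by (rule exI[of _ "\<lambda>i. g i + h i"])
  next
    fix r x assume "x \<in> ?I"
    then obtain g where "x = (\<Sum>i\<in>UNIV. g i * Var i ^ W i)" by blast
    then have "r * x = (\<Sum>i\<in>UNIV. (r * g i) * Var i ^ W i)"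
      by (simp add: sum_distrib_left mult.assoc)
    then show "r * x \<in> ?I" unfolding mem_Collect_eq by (rule exI[of _ "\<lambda>i. r * g i"])
  qed
  moreover have "monom ` {\<lambda>j. if j = i then W i else 0 | i. True} \<subseteq> ?I"
  proof clarify
    fix i
    have "(\<Sum>l\<in>UNIV. (if l = i then 1 else 0) * Var l ^ W l :: ('v, 'k) mpoly)
        = (\<Sum>l\<in>UNIV. if l = i then Var l ^ W l else 0)"
      by (intro sum.cong) auto
    then have "monom (\<lambda>j. if j = i then W i else 0) = (\<Sum>l\<in>UNIV. (if l = i then 1 else 0) * Var l ^ W l :: ('v, 'k) mpoly)"
      by (simp add: Var_power)
    then show "\<exists>g. monom (\<lambda>j. if j = i then W i else 0) = (\<Sum>i\<in>UNIV. g i * Var i ^ W i :: ('v, 'k) mpoly)"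
      by (rule exI[of _ "\<lambda>l. if l = i then 1 else 0"])
  qed
  moreover have "f ^ Suc (sum W UNIV) \<in> ideal_gen (monom ` {\<lambda>j. if j = i then W i else 0 | i. True})"
    unfolding mem_ideal_gen_monom
  proof
    fix k assume "k \<in> keys (f ^ Suc (sum W UNIV))"
    then have "sum W UNIV < sum (lookup k) UNIV"
      using high[of "Suc (sum W UNIV)"] by (auto simp: deg_def)
    then obtain i where "W i < lookup k i" by (metis not_le sum_mono)
    then have "(\<lambda>j. if j = i then W i else 0) \<le> lookup k" by (auto simp: le_fun_def)
    then show "\<exists>e\<in>{\<lambda>j. if j = i then W i else 0 | i. True}. e \<le> lookup k" by blast
  qed
  ultimately have "f ^ Suc (sum W UNIV) \<in> ?I" using ideal_gen_least by blast
  then show thesis using that by blast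
qed

text \<open>Dropping the last element of the sequence lowers by one the degree from which homology
  is known to vanish. For the full sequence that degree exceeds the number of variables, where there
  are no forms.\<close>

lemma kexact_regular_seq:
  fixes J :: "('v::finite, 'k::comm_ring_1) mpoly set"
  assumes "regular_seq_quot J fs" "inj num" "is_ideal J" "card (UNIV :: 'v set) < d + length fs"
  shows "kexact num (\<lambda>i. Var i ^ W i) J d"
proof -
  \<comment> \<open>The degree is generalized because it rises together with the prefix length
    \<open>i\<close>, which preserves the inequality.\<close>
  have "kexact num (\<lambda>i. Var i ^ W i) (ideal_gen (J \<union> set (take i fs))) d"
    if "i \<le> length fs" "card (UNIV :: 'v set) + i < d + length fs" for i d
    using that
  proof (induction i arbitrary: d rule: inc_induct)
    case base
    then have "card S \<noteq> d" for S :: "'v set"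
      using card_mono[of UNIV S] by auto
    then show ?case by (auto simp: kexact_def)
  next
    case (step i)
    let ?f = "fs ! i"
    have take: "J \<union> set (take (Suc i) fs) = insert ?f (J \<union> set (take i fs))"
      using step.hyps by (simp add: take_Suc_conv_app_nth)
    have "?f \<in> max_ideal"
      using assms(1) nth_mem[OF step.hyps(2)] by (auto simp: regular_seq_quot_def)
    then obtain N g where "?f ^ N = (\<Sum>i\<in>UNIV. g i * Var i ^ W i)"
      using max_ideal_nilpotent by blast
    moreover have "kexact num (\<lambda>i. Var i ^ W i) (ideal_gen (insert ?f (J \<union> set (take i fs)))) (Suc d)"
      using step.IH[of "Suc d"] step.prems unfolding take by simp
    moreover have "?f * g \<in> ideal_gen (J \<union> set (take i fs)) \<Longrightarrow> g \<in> ideal_gen (J \<union> set (take i fs))" for g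
      using assms(1) step.hyps(2) unfolding regular_seq_quot_def by blast
    ultimately show ?case
      using kexact_regular_element[OF assms(2) refl, of ?f "J \<union> set (take i fs)"] by blast
  qed
  from this[of 0 d] have "kexact num (\<lambda>i. Var i ^ W i) (ideal_gen J) d"
    using assms(4) by simp
  moreover have "ideal_gen J = J"
    using ideal_gen_least[OF assms(3), of J] ideal_gen_superset[of J] by blast
  ultimately show ?thesis by simp
qed

subsection \<open>Irreducible decompositions\<close>

lemma irr_ideal_eq:
  "(irr_ideal b :: ('v::finite, 'k::comm_ring_1) mpoly set) =
    ideal_gen (monom ` {\<lambda>j. if j = i then b i else 0 | i. 1 \<le> b i})"
  unfolding irr_ideal_def Var_power by (rule arg_cong[where f = ideal_gen]) auto

lemma mem_irr_ideal:
  "(p :: ('v::finite, 'k::comm_ring_1) mpoly) \<in> irr_ideal b \<longleftrightarrow>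
    (\<forall>k\<in>keys p. \<exists>i. 1 \<le> b i \<and> b i \<le> lookup k i)"
proof -
  have "(\<exists>e\<in>{\<lambda>j. if j = i then b i else 0 | i. 1 \<le> b i}. e \<le> lookup k) \<longleftrightarrow>
      (\<exists>i. 1 \<le> b i \<and> b i \<le> lookup k i)" for k
  proof
    assume "\<exists>e\<in>{\<lambda>j. if j = i then b i else 0 | i. 1 \<le> b i}. e \<le> lookup k"
    then obtain i where i: "1 \<le> b i" "(\<lambda>j. if j = i then b i else 0) \<le> lookup k" by blast
    then have "b i \<le> lookup k i" using le_funD[OF i(2), of i] by simp
    then show "\<exists>i. 1 \<le> b i \<and> b i \<le> lookup k i" using i(1) by blast
  next
    assume "\<exists>i. 1 \<le> b i \<and> b i \<le> lookup k i"
    then obtain i where "1 \<le> b i" "b i \<le> lookup k i" by blast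
    then show "\<exists>e\<in>{\<lambda>j. if j = i then b i else 0 | i. 1 \<le> b i}. e \<le> lookup k"
      by (intro bexI[of _ "\<lambda>j. if j = i then b i else 0"]) (auto simp: le_fun_def)
  qed
  then show ?thesis unfolding irr_ideal_eq mem_ideal_gen_monom by simp
qed

lemma monom_mem_irr_ideal:
  "(monom a :: ('v::finite, 'k::field) mpoly) \<in> irr_ideal b \<longleftrightarrow> (\<exists>i. 1 \<le> b i \<and> b i \<le> a i)"
  by (simp add: mem_irr_ideal keys_monom)

text \<open>A decomposition with the fewest components is irredundant. This is what gives meaning to
  the choice in \<open>Irr\<close>.\<close>

lemma is_irr_decomp_exists:
  assumes "finite B" "I = \<Inter>{irr_ideal b | b. b \<in> B}"
  shows "\<exists>B. is_irr_decomp I B"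
proof -
  define dec where "dec B \<longleftrightarrow> finite B \<and> I = \<Inter>{irr_ideal b | b. b \<in> B}" for B
  have "dec B" using assms by (simp add: dec_def)
  from ex_has_least_nat[of dec, OF this, of card]
  obtain B where "dec B" and min: "\<And>C. dec C \<Longrightarrow> card B \<le> card C" by blast
  then have B: "finite B" "I = \<Inter>{irr_ideal b | b. b \<in> B}" by (simp_all add: dec_def)
  have "\<Inter>{irr_ideal c | c. c \<in> B - {b}} \<noteq> I" if "b \<in> B" for b
  proof
    assume "\<Inter>{irr_ideal c | c. c \<in> B - {b}} = I"
    then have "dec (B - {b})" using B(1) by (simp add: dec_def)
    then have "card B \<le> card (B - {b})" by (rule min)
    then show False using card_Diff1_less[OF B(1) that] by simp
  qed
  then have "is_irr_decomp I B" unfolding is_irr_decomp_def using B by simp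
  then show ?thesis by (rule exI)
qed

text \<open>A divisor of \<open>a\<close> of least total degree among those in \<open>I\<close> is a
  minimal generator.\<close>

lemma min_gens_below:
  assumes "(monom a :: ('v::finite, 'k::field) mpoly) \<in> I"
  obtains g where "g \<in> min_gens I" "g \<le> a"
proof -
  obtain g where g: "(monom g :: ('v, 'k) mpoly) \<in> I" "g \<le> a"
    and min: "\<And>h. (monom h :: ('v, 'k) mpoly) \<in> I \<Longrightarrow> h \<le> a \<Longrightarrow> sum g UNIV \<le> sum h UNIV"
    using ex_has_least_nat[of "\<lambda>g. (monom g :: ('v, 'k) mpoly) \<in> I \<and> g \<le> a" a "\<lambda>g. sum g UNIV"] assms
    by blast
  have "c = g" if c: "(monom c :: ('v, 'k) mpoly) \<in> I" "c \<le> g" for c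
  proof (rule ccontr)
    assume "c \<noteq> g"
    then obtain i where "c i < g i" using c(2) by (metis ext le_funD order_le_less)
    then have "sum c UNIV < sum g UNIV"
      using c(2) by (intro sum_strict_mono_ex1) (auto simp: le_fun_def)
    moreover have "c \<le> a" using c(2) g(2) by (rule order_trans)
    ultimately show False using min[OF c(1)] by simp
  qed
  then show thesis using that g unfolding min_gens_def by blast
qed

lemma min_gens_subset:
  "min_gens (ideal_gen (monom ` G) :: ('v::finite, 'k::field) mpoly set) \<subseteq> G"
proof
  fix g assume "g \<in> min_gens (ideal_gen (monom ` G) :: ('v, 'k) mpoly set)"
  then have "(monom g :: ('v, 'k) mpoly) \<in> ideal_gen (monom ` G)"
    and min: "\<And>c. (monom c :: ('v, 'k) mpoly) \<in> ideal_gen (monom ` G) \<Longrightarrow> c \<le> g \<Longrightarrow> c = g"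
    by (auto simp: min_gens_def)
  then obtain e where e: "e \<in> G" "e \<le> g" by (auto simp: monom_mem_ideal_gen_monom)
  then have "e = g" using min[of e] by (auto simp: monom_mem_ideal_gen_monom)
  then show "g \<in> G" using e by simp
qed

text \<open>This bound keeps the truncated subtraction in \<open>dual_exp\<close> positive on the
  support of \<open>b\<close>. Irredundancy gives a monomial outside only the component
  \<open>b\<close>; if \<open>b i\<close> were too large, raising its exponent at \<open>i\<close>
  would lead to a contradiction.\<close>

lemma irr_component_le_lcm_exp:
  fixes I :: "('v::finite, 'k::field) mpoly set"
  assumes dec: "is_irr_decomp I B" and b: "b \<in> B" and I: "I = ideal_gen (monom ` G)" and G: "finite G"
  shows "b i \<le> lcm_exp I i"
proof (rule ccontr)
  assume "\<not> b i \<le> lcm_exp I i"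
  then have less: "lcm_exp I i < b i" by simp
  have I_eq: "I = \<Inter>{irr_ideal c | c. c \<in> B}" using dec by (simp add: is_irr_decomp_def)
  have "\<Inter>{irr_ideal c | c. c \<in> B - {b}} \<noteq> I" using dec b unfolding is_irr_decomp_def by blast
  moreover have "I \<subseteq> \<Inter>{irr_ideal c | c. c \<in> B - {b}}" using I_eq by blast
  ultimately obtain p where p: "\<And>c. c \<in> B - {b} \<Longrightarrow> p \<in> irr_ideal c" "p \<notin> I" by blast
  then have "p \<notin> irr_ideal b" using I_eq by blast
  then obtain k where k: "k \<in> keys p" "\<And>j. 1 \<le> b j \<Longrightarrow> lookup k j < b j"
    unfolding mem_irr_ideal by (metis not_le)
  \<comment> \<open>Raising the exponent at \<open>i\<close> moves the monomial into
    \<open>I\<close>. A minimal generator below \<open>l\<close> is too small at \<open>i\<close> to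
    enter the component \<open>b\<close> there, so it enters at another index, where
    \<open>l\<close> and \<open>k\<close> agree.\<close>
  define l where "l = (lookup k)(i := b i + lookup k i)"
  have "(monom l :: ('v, 'k) mpoly) \<in> irr_ideal c" if "c \<in> B" for c
  proof (cases "c = b")
    case True
    then show ?thesis using less by (auto simp: monom_mem_irr_ideal l_def intro!: exI[of _ i])
  next
    case False
    then obtain j where "1 \<le> c j" "c j \<le> lookup k j" using p(1)[of c] \<open>c \<in> B\<close> k(1) by (auto simp: mem_irr_ideal)
    then show ?thesis by (auto simp: monom_mem_irr_ideal l_def intro!: exI[of _ j])
  qed
  then have "(monom l :: ('v, 'k) mpoly) \<in> I" using I_eq by blast
  then obtain g where g: "g \<in> min_gens I" "g \<le> l" by (rule min_gens_below)
  have "finite (min_gens I)" using min_gens_subset G unfolding I by (rule finite_subset)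
  then have "g i \<le> lcm_exp I i"
    unfolding lcm_exp_def using g(1) by (intro Max_ge) (auto simp: setcompr_eq_image)
  moreover have "(monom g :: ('v, 'k) mpoly) \<in> irr_ideal b" using g(1) b I_eq by (auto simp: min_gens_def)
  then obtain j where j: "1 \<le> b j" "b j \<le> g j" by (auto simp: monom_mem_irr_ideal)
  ultimately have "j \<noteq> i" using less by auto
  then have "b j \<le> lookup k j" using j le_funD[OF g(2), of j] by (simp add: l_def)
  then show False using k(2)[OF j(1)] by simp
qed

lemma alexander_dual_eq:
  fixes I :: "('v::finite, 'k::comm_ring_1) mpoly set"
  shows "alexander_dual I = ideal_gen (monom ` dual_exp (lcm_exp I) ` Irr I)"
  unfolding alexander_dual_def by (rule arg_cong[where f = ideal_gen]) auto

subsection \<open>Edge ideals\<close>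

definition edge_exp :: "('v \<Rightarrow> nat) \<Rightarrow> 'v \<Rightarrow> 'v \<Rightarrow> 'v \<Rightarrow> nat" where
  "edge_exp w i j v = (if v = i then 1 else 0) + (if v = j then w j else 0)"

lemma edge_ideal_eq:
  "(edge_ideal E w :: ('v::finite, 'k::comm_ring_1) mpoly set) =
    ideal_gen (monom ` {edge_exp w i j | i j. (i, j) \<in> E})"
proof -
  have "Var i * Var j ^ w j = (monom (edge_exp w i j) :: ('v, 'k) mpoly)" for i j
    using Var_power[of i 1, where ?'k = 'k] by (simp add: Var_power monom_mult edge_exp_def[abs_def])
  then show ?thesis unfolding edge_ideal_def by (intro arg_cong[where f = ideal_gen]) auto
qed

lemma edge_exp_le_iff: "i \<noteq> j \<Longrightarrow> edge_exp w i j \<le> a \<longleftrightarrow> 1 \<le> a i \<and> w j \<le> a j"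
  by (auto simp: edge_exp_def le_fun_def)

lemma finite_le_fun: "finite {b :: 'v::finite \<Rightarrow> nat. b \<le> w}"
proof -
  have "{b. b \<le> w} = (\<Pi>\<^sub>E i\<in>UNIV. {..w i})" by (auto simp: le_fun_def PiE_def Pi_def)
  then show ?thesis by (simp add: finite_PiE)
qed

context
  fixes E :: "('v::finite \<times> 'v) set" and w :: "'v \<Rightarrow> nat"
  assumes graph: "weighted_oriented_graph E w"
begin

lemma edge_distinct: "(i, j) \<in> E \<Longrightarrow> i \<noteq> j"
  using graph by (auto simp: weighted_oriented_graph_def)

lemma weight_pos: "0 < w i"
  using graph by (auto simp: weighted_oriented_graph_def)

text \<open>Any monomial outside the edge ideal is excluded by an irreducible ideal over it with
  exponents bounded by \<open>w\<close>. The bound makes the family finite.\<close>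

lemma edge_ideal_decomp:
  "(edge_ideal E w :: ('v, 'k::field) mpoly set) =
    \<Inter>{irr_ideal b | b. b \<in> {b. b \<le> w \<and> (edge_ideal E w :: ('v, 'k) mpoly set) \<subseteq> irr_ideal b}}"
proof (rule antisym)
  show "(edge_ideal E w :: ('v, 'k) mpoly set) \<subseteq>
    \<Inter>{irr_ideal b | b. b \<in> {b. b \<le> w \<and> (edge_ideal E w :: ('v, 'k) mpoly set) \<subseteq> irr_ideal b}}" by blast
next
  show "\<Inter>{irr_ideal b | b. b \<in> {b. b \<le> w \<and> (edge_ideal E w :: ('v, 'k) mpoly set) \<subseteq> irr_ideal b}}
    \<subseteq> (edge_ideal E w :: ('v, 'k) mpoly set)"
  proof (rule subsetI, rule ccontr)
    fix p :: "('v, 'k) mpoly"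
    assume p: "p \<in> \<Inter>{irr_ideal b | b. b \<in> {b. b \<le> w \<and> (edge_ideal E w :: ('v, 'k) mpoly set) \<subseteq> irr_ideal b}}"
      and "p \<notin> edge_ideal E w"
    then obtain k where k: "k \<in> keys p" "\<And>i j. (i, j) \<in> E \<Longrightarrow> \<not> edge_exp w i j \<le> lookup k"
      unfolding edge_ideal_eq mem_ideal_gen_monom by blast
    \<comment> \<open>At each index this takes the first power of the variable not dividing the
      given monomial, and omits the variable when that power would exceed
      \<open>w i\<close>.\<close>
    define b where "b i = (if lookup k i < w i then lookup k i + 1 else 0)" for i
    have "(edge_ideal E w :: ('v, 'k) mpoly set) \<subseteq> irr_ideal b"
      unfolding edge_ideal_eq
    proof (rule ideal_gen_least)
      show "is_ideal (irr_ideal b :: ('v, 'k) mpoly set)" unfolding irr_ideal_def by (rule is_ideal_ideal_gen)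
      show "monom ` {edge_exp w i j |i j. (i, j) \<in> E} \<subseteq> (irr_ideal b :: ('v, 'k) mpoly set)"
      proof clarify
        fix i j assume ij: "(i, j) \<in> E"
        then have "lookup k i = 0 \<or> lookup k j < w j"
          using k(2)[OF ij] edge_exp_le_iff[OF edge_distinct[OF ij]] by (metis less_one not_le)
        then have "1 \<le> b i \<and> b i \<le> edge_exp w i j i \<or> 1 \<le> b j \<and> b j \<le> edge_exp w i j j"
          using weight_pos[of i] by (auto simp: b_def edge_exp_def)
        then show "(monom (edge_exp w i j) :: ('v, 'k) mpoly) \<in> irr_ideal b"
          unfolding monom_mem_irr_ideal by blast
      qed
    qed
    moreover have "b \<le> w" by (auto simp: b_def le_fun_def)
    ultimately have "p \<in> irr_ideal b" using p by blast
    then obtain i where "1 \<le> b i" "b i \<le> lookup k i" using k(1) by (auto simp: mem_irr_ideal)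
    then show False by (auto simp: b_def split: if_splits)
  qed
qed

lemma is_irr_decomp_Irr:
  "is_irr_decomp (edge_ideal E w :: ('v, 'k::field) mpoly set) (Irr (edge_ideal E w :: ('v, 'k) mpoly set))"
  unfolding Irr_def
proof (rule someI_ex, rule is_irr_decomp_exists)
  show "finite {b. b \<le> w \<and> (edge_ideal E w :: ('v, 'k) mpoly set) \<subseteq> irr_ideal b}"
    by (rule finite_subset[OF _ finite_le_fun[of w]]) blast
qed (rule edge_ideal_decomp)

lemma finite_edge_exps: "finite {edge_exp w i j | i j. (i, j) \<in> E}"
proof -
  have "{edge_exp w i j | i j. (i, j) \<in> E} = (\<lambda>(i, j). edge_exp w i j) ` E" by auto
  then show ?thesis by simp
qed

lemma lcm_exp_edge_ideal_le: "lcm_exp (edge_ideal E w :: ('v, 'k::field) mpoly set) i \<le> w i"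
proof -
  let ?M = "min_gens (edge_ideal E w :: ('v, 'k) mpoly set)"
  have sub: "?M \<subseteq> {edge_exp w i j | i j. (i, j) \<in> E}" unfolding edge_ideal_eq by (rule min_gens_subset)
  then have "finite ?M" using finite_edge_exps by (rule finite_subset)
  moreover have "a i \<le> w i" if "a \<in> ?M" for a
  proof -
    from that sub obtain p q where "a = edge_exp w p q" "(p, q) \<in> E" by blast
    moreover from this(2) have "p \<noteq> q" by (rule edge_distinct)
    ultimately show ?thesis using weight_pos[of i] by (auto simp: edge_exp_def)
  qed
  ultimately show ?thesis unfolding lcm_exp_def by (subst Max_le_iff) (auto simp: setcompr_eq_image)
qed

text \<open>Every component contains the monomial of the edge, so its exponent is positive at
  \<open>p\<close> or \<open>q\<close>; the bound by \<open>lcm_exp\<close> keeps the dual exponent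
  positive there.\<close>

lemma alexander_dual_subset_var_prime:
  assumes "(p, q) \<in> E"
  shows "alexander_dual (edge_ideal E w :: ('v, 'k::field) mpoly set) \<subseteq> var_prime {p, q}"
proof -
  let ?I = "edge_ideal E w :: ('v, 'k) mpoly set"
  have "dual_exp (lcm_exp ?I) b p \<noteq> 0 \<or> dual_exp (lcm_exp ?I) b q \<noteq> 0" if b: "b \<in> Irr ?I" for b
  proof -
    have "?I \<subseteq> irr_ideal b" using is_irr_decomp_Irr[where ?'k = 'k] b unfolding is_irr_decomp_def by blast
    moreover have "monom (edge_exp w p q) \<in> ?I"
      unfolding edge_ideal_eq using assms by (auto simp: monom_mem_ideal_gen_monom)
    ultimately have "(monom (edge_exp w p q) :: ('v, 'k) mpoly) \<in> irr_ideal b" by blast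
    then obtain i where i: "1 \<le> b i" "b i \<le> edge_exp w p q i" unfolding monom_mem_irr_ideal by blast
    have "b i \<le> lcm_exp ?I i"
      by (rule irr_component_le_lcm_exp[OF is_irr_decomp_Irr b edge_ideal_eq finite_edge_exps])
    then have "dual_exp (lcm_exp ?I) b i \<noteq> 0" using i by (auto simp: dual_exp_def)
    moreover have "i = p \<or> i = q" using i by (auto simp: edge_exp_def split: if_splits)
    ultimately show ?thesis by blast
  qed
  then have "\<exists>i\<in>{p, q}. lookup k i \<noteq> 0"
    if "\<exists>e\<in>dual_exp (lcm_exp ?I) ` Irr ?I. e \<le> lookup k" for k
    using that by (metis (no_types, lifting) image_iff insertI1 insertI2 le_funD le_zero_eq)
  then show ?thesis
    unfolding alexander_dual_eq var_prime_def subset_iff mem_ideal_gen_monom by blast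
qed

text \<open>No monomial supported on the independent set \<open>T\<close> lies in the edge ideal, so
  some component uses no variable of \<open>T\<close>. Its dual generator is trivial on
  \<open>T\<close> and bounded by \<open>w\<close> elsewhere.\<close>

lemma monom_mem_alexander_dual:
  assumes indep: "\<And>i j. (i, j) \<in> E \<Longrightarrow> \<not> (i \<in> T \<and> j \<in> T)" and a: "\<And>i. i \<notin> T \<Longrightarrow> w i \<le> a i"
  shows "monom a \<in> alexander_dual (edge_ideal E w :: ('v, 'k::field) mpoly set)"
proof -
  let ?I = "edge_ideal E w :: ('v, 'k) mpoly set"
  have dec: "finite (Irr ?I)" "?I = \<Inter>{irr_ideal b | b. b \<in> Irr ?I}"
    using is_irr_decomp_Irr[where ?'k = 'k] unfolding is_irr_decomp_def by auto
  \<comment> \<open>\<open>N\<close> exceeds every exponent of every component, so a component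
    missing the \<open>N\<close>-th powers on \<open>T\<close> must vanish on
    \<open>T\<close>.\<close>
  define N where "N = Suc (\<Sum>b\<in>Irr ?I. \<Sum>i\<in>UNIV. b i)"
  have N: "b i < N" if "b \<in> Irr ?I" for b i
  proof -
    have "b i \<le> (\<Sum>i\<in>UNIV. b i)" by (rule member_le_sum) auto
    also have "\<dots> \<le> (\<Sum>b\<in>Irr ?I. \<Sum>i\<in>UNIV. b i)" using that dec(1) by (intro member_le_sum[of b]) auto
    finally show ?thesis by (simp add: N_def)
  qed
  have "(monom (\<lambda>i. if i \<in> T then N else 0) :: ('v, 'k) mpoly) \<notin> ?I"
  proof
    assume "(monom (\<lambda>i. if i \<in> T then N else 0) :: ('v, 'k) mpoly) \<in> ?I"
    then obtain i j where "(i, j) \<in> E" "edge_exp w i j \<le> (\<lambda>i. if i \<in> T then N else 0)"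
      unfolding edge_ideal_eq by (auto simp: monom_mem_ideal_gen_monom)
    then show False
      using indep[of i j] edge_exp_le_iff[OF edge_distinct, of i j w] weight_pos[of j]
      by (auto split: if_splits)
  qed
  then obtain b where b: "b \<in> Irr ?I" "(monom (\<lambda>i. if i \<in> T then N else 0) :: ('v, 'k) mpoly) \<notin> irr_ideal b"
    using dec(2) by blast
  have "dual_exp (lcm_exp ?I) b i \<le> a i" for i
  proof (cases "i \<in> T")
    case True
    then have "b i = 0" using b(2) N[OF b(1), of i] unfolding monom_mem_irr_ideal
      by (metis less_imp_le less_one not_le)
    then show ?thesis by (simp add: dual_exp_def)
  next
    case False
    then show ?thesis using a[OF False] lcm_exp_edge_ideal_le[where ?'k = 'k, of i]
      unfolding dual_exp_def by (cases "1 \<le> b i") simp_all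
  qed
  then show ?thesis
    unfolding alexander_dual_eq monom_mem_ideal_gen_monom using b(1) by (auto simp: le_fun_def)
qed

end

subsection \<open>A Koszul cycle from an induced cycle of the complement\<close>

text \<open>The cycle \<open>z\<close> triangulates the disk bounded by \<open>cs\<close>, coned from \<open>cs ! 0\<close>; \<open>num\<close> orders the
  vertices along \<open>cs\<close>. The exponent \<open>Suc (w i)\<close> off \<open>cs\<close> exceeds the exponent of \<open>x\<^sub>i\<close> in the
  multidegree of \<open>z\<close>, so that no index outside \<open>cs\<close> can occur in that degree.\<close>

lemma not_kexact_cycle:
  fixes E :: "('v::finite \<times> 'v) set" and w :: "'v \<Rightarrow> nat" and num :: "'v \<Rightarrow> nat"
    and J :: "('v, 'k::field) mpoly set"
  assumes num: "inj num"
    and cyc: "induced_cycle (complement_adj (underlying_adj E)) cs" and m: "4 \<le> length cs"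
    and num_cs: "\<And>k. k < length cs \<Longrightarrow> num (cs ! k) = k"
    and loopless: "\<And>p q. (p, q) \<in> E \<Longrightarrow> p \<noteq> q"
    and J: "is_ideal J" and J_sub: "\<And>p q. (p, q) \<in> E \<Longrightarrow> J \<subseteq> var_prime {p, q}"
    and J_mem: "\<And>T a. (\<And>i j. (i, j) \<in> E \<Longrightarrow> \<not> (i \<in> T \<and> j \<in> T)) \<Longrightarrow>
      (\<And>i. i \<notin> T \<Longrightarrow> w i \<le> a i) \<Longrightarrow> monom a \<in> J"
  shows "\<not> kexact num (\<lambda>i. Var i ^ (if i \<in> set cs then w i else Suc (w i))) J 3"
proof
  let ?m = "length cs" and ?c = "\<lambda>k. cs ! k"
  define W where "W i = (if i \<in> set cs then w i else Suc (w i))" for i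
  let ?bd = "kbd num (\<lambda>i. Var i ^ W i :: ('v, 'k) mpoly)"
  \<comment> \<open>For \<open>T\<close> inside the cycle, \<open>monom (ex T)\<close> times the
    wedge on \<open>T\<close> has multidegree \<open>w\<close>, since the wedge factor at
    \<open>i\<close> carries degree \<open>W i = w i\<close>. Thus \<open>z\<close> is
    homogeneous.\<close>
  define ex where "ex T i = (if i \<in> T then 0 else w i)" for T :: "'v set" and i
  define tri where "tri S \<longleftrightarrow> (\<exists>k\<ge>1. Suc k < ?m \<and> num ` S = {0, k, Suc k})" for S
  define z where "z S = (if tri S then monom (ex S) else 0 :: ('v, 'k) mpoly)" for S

  have num_eq: "i = ?c k" if "num i = k" "k < ?m" for i k
    using num num_cs[OF that(2)] that(1) by (metis injD)
  have img: "num ` {?c k, ?c l} = {k, l}" if "k < ?m" "l < ?m" for k l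
    using num_cs that by simp
  have adj: "underlying_adj E (?c k) (?c l) \<longleftrightarrow> \<not> (l = (k + 1) mod ?m \<or> k = (l + 1) mod ?m)"
    if "k < ?m" "l < ?m" "k \<noteq> l" for k l
  proof -
    have "?c k \<noteq> ?c l" using num_cs that by metis
    then show ?thesis using cyc that unfolding induced_cycle_def complement_adj_def by metis
  qed

  \<comment> \<open>Multiplying by the power of \<open>Var i\<close> fills the gap of the exponent
    at \<open>i\<close>, so all terms share one monomial and only a signed count of triangles
    remains.\<close>
  have bd_z: "?bd z T = (\<Sum>i\<in>{i. i \<notin> T \<and> tri (insert i T)}. ksgn num i T) * monom (ex T)" for T
  proof -
    have "Var i ^ W i * z (insert i T) = (if tri (insert i T) then monom (ex T) else 0)"
      if "i \<notin> T" for i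
    proof (cases "tri (insert i T)")
      case True
      then obtain k where "num i \<in> {0, k, Suc k}" "Suc k < ?m" unfolding tri_def by blast
      then have "num i < ?m" by auto
      then have "i \<in> set cs" using num_eq[of i "num i"] nth_mem by metis
      then have "(\<lambda>j. (if j = i then W i else 0) + ex (insert i T) j) = ex T"
        using that by (auto simp: ex_def W_def)
      then show ?thesis using True by (simp add: z_def Var_power monom_mult)
    qed (simp add: z_def)
    then have "?bd z T = (\<Sum>i\<in>- T. if tri (insert i T) then ksgn num i T * monom (ex T) else 0)"
      unfolding kbd_def by (intro sum.cong) (auto simp: mult.assoc)
    also have "\<dots> = (\<Sum>i\<in>{i. i \<notin> T \<and> tri (insert i T)}. ksgn num i T * monom (ex T))"
      by (simp add: sum.If_cases Int_def)
    finally show ?thesis by (simp add: sum_distrib_right)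
  qed

  \<comment> \<open>A pair adjacent in the graph is never a side of the polygon. It is either in no
    triangle or a diagonal from vertex 0, shared by two triangles with opposite signs.\<close>
  have cancel: "(\<Sum>i\<in>{i. i \<notin> {p, q} \<and> tri (insert i {p, q})}. ksgn num i {p, q} :: ('v, 'k) mpoly) = 0"
    if pq: "underlying_adj E p q" "num p < num q" for p q
  proof (cases "\<exists>i. i \<notin> {p, q} \<and> tri (insert i {p, q})")
    case False
    then have "{i. i \<notin> {p, q} \<and> tri (insert i {p, q})} = {}" by blast
    then show ?thesis by (simp only: sum.empty)
  next
    case True
    then obtain i k where k: "1 \<le> k" "Suc k < ?m" "{num i, num p, num q} = {0, k, Suc k}"
      unfolding tri_def by auto
    then have "num p \<in> {0, k, Suc k}" "num q \<in> {0, k, Suc k}" by blast+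
    then have lt: "num p < ?m" "num q < ?m" using k(2) by auto
    then have c: "p = ?c (num p)" "q = ?c (num q)" using num_eq by blast+
    have ne: "num q \<noteq> (num p + 1) mod ?m" "num p \<noteq> (num q + 1) mod ?m"
      using adj[OF lt] c pq by auto
    then have q1: "num q \<noteq> num p + 1" using lt by auto
    have p0: "num p = 0"
      using \<open>num p \<in> _\<close> \<open>num q \<in> _\<close> pq(2) q1 by auto
    define l where "l = num q"
    \<comment> \<open>The last vertex is joined to vertex 0 by the closing side of the
      polygon.\<close>
    have "l \<noteq> ?m - 1"
    proof
      assume "l = ?m - 1"
      then have "num q + 1 = ?m" using m by (simp add: l_def)
      then have "(num q + 1) mod ?m = 0" by simp
      then show False using ne(2) p0 by simp
    qed
    then have l: "2 \<le> l" "Suc l < ?m" using q1 p0 pq(2) lt by (auto simp: l_def)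
    have pc: "p = ?c 0" "q = ?c l" using c p0 by (auto simp: l_def)
    have "{i. i \<notin> {p, q} \<and> tri (insert i {p, q})} = {?c (l - 1), ?c (l + 1)}"
    proof (intro equalityI subsetI)
      fix i assume "i \<in> {i. i \<notin> {p, q} \<and> tri (insert i {p, q})}"
      then obtain k where i: "i \<notin> {p, q}" and k: "1 \<le> k" "Suc k < ?m" "{num i, 0, l} = {0, k, Suc k}"
        unfolding tri_def using p0 by (auto simp: l_def)
      have "num i \<noteq> num p" "num i \<noteq> num q" using i num by (auto dest: injD)
      then have "num i \<noteq> 0" "num i \<noteq> l" by (simp_all add: p0 l_def)
      moreover have "num i \<in> {0, k, Suc k}" "l \<in> {0, k, Suc k}" "k \<in> {num i, 0, l}" "Suc k \<in> {num i, 0, l}"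
        using k(3) by blast+
      ultimately have "num i = l - 1 \<or> num i = l + 1" using l by auto
      then show "i \<in> {?c (l - 1), ?c (l + 1)}" using num_eq[of i] l by auto
    next
      fix i assume "i \<in> {?c (l - 1), ?c (l + 1)}"
      then have i: "num i = l - 1 \<or> num i = l + 1" using num_cs l by auto
      then have "tri (insert i {p, q})"
      proof
        assume "num i = l - 1"
        then have "num ` insert i {p, q} = {0, l - 1, Suc (l - 1)}"
          using p0 l by (auto simp: l_def)
        then show ?thesis unfolding tri_def using l by (intro exI[of _ "l - 1"]) auto
      next
        assume "num i = l + 1"
        then have "num ` insert i {p, q} = {0, l, Suc l}"
          using p0 l by (auto simp: l_def)
        then show ?thesis unfolding tri_def using l by (intro exI[of _ l]) auto
      qed
      moreover have "i \<notin> {p, q}" using i p0 l by (auto simp: l_def)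
      ultimately show "i \<in> {i. i \<notin> {p, q} \<and> tri (insert i {p, q})}" by blast
    qed
    moreover have "?c (l - 1) \<noteq> ?c (l + 1)"
      using num_cs[of "l - 1"] num_cs[of "l + 1"] l by (metis Suc_eq_plus1 Suc_lessD diff_le_self le_less_trans less_irrefl lessI)
    moreover have "ksgn num (?c (l - 1)) {p, q} = (- 1 :: ('v, 'k) mpoly)"
      "ksgn num (?c (l + 1)) {p, q} = (1 :: ('v, 'k) mpoly)"
      using num_cs[of "l - 1"] num_cs[of "l + 1"] l p0 by (auto simp: ksgn_pair l_def[symmetric])
    ultimately show ?thesis by simp
  qed

  assume "kexact num (\<lambda>i. Var i ^ (if i \<in> set cs then w i else Suc (w i))) J 3"
  then have exact: "kexact num (\<lambda>i. Var i ^ W i) J 3" by (simp add: W_def)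
  \<comment> \<open>Modulo \<open>J\<close>, \<open>z\<close> is a cycle: on pairs adjacent in the
    graph the signs cancel, and on independent pairs the monomial itself lies in
    \<open>J\<close>.\<close>
  have "?bd z T \<in> J" if T: "card T + 1 = 3" for T
  proof (cases "\<exists>i j. (i, j) \<in> E \<and> i \<in> T \<and> j \<in> T")
    case True
    then obtain i j where ij: "underlying_adj E i j" "i \<in> T" "j \<in> T" "i \<noteq> j"
      using loopless by (auto simp: underlying_adj_def)
    have T_eq: "T = {i, j}"
      using T ij by (intro card_seteq[symmetric]) auto
    have "num i < num j \<or> num j < num i" using ij(4) num by (metis injD linorder_neqE_nat)
    then obtain p q where "underlying_adj E p q" "num p < num q" "T = {p, q}"
      using ij(1) T_eq by (metis insert_commute underlying_adj_def)
    then show ?thesis unfolding bd_z using cancel ideal_zero[OF J] by simp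
  next
    case False
    have "monom (ex T) \<in> J"
    proof (rule J_mem)
      fix i j assume "(i, j) \<in> E"
      then show "\<not> (i \<in> T \<and> j \<in> T)" using False by blast
    qed (simp add: ex_def)
    then show ?thesis unfolding bd_z by (rule ideal_mult[OF J])
  qed
  then obtain t where t: "\<And>S. card S = 3 \<Longrightarrow> z S - ?bd t S \<in> J"
    using exact unfolding kexact_def by blast
  \<comment> \<open>This side of the polygon lies in exactly one triangle, so the boundary of
    \<open>z\<close> has coefficient 1 there.\<close>
  let ?T = "{?c 1, ?c 2}"
  have m0: "0 < ?m" using m by linarith
  have c12: "num (?c 1) = 1" "num (?c 2) = 2" using num_cs m by auto
  then have "?c 1 \<noteq> ?c 2" by (auto dest: arg_cong[where f = num])
  have apex: "{i. i \<notin> ?T \<and> tri (insert i ?T)} = {?c 0}"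
  proof (intro equalityI subsetI)
    fix i assume "i \<in> {i. i \<notin> ?T \<and> tri (insert i ?T)}"
    then obtain k where "1 \<le> k" "{num i, 1, 2} = {0, k, Suc k}"
      unfolding tri_def using c12 by auto
    then have "0 \<in> {num i, 1, 2}" by blast
    then show "i \<in> {?c 0}" using num_eq[of i 0] m0 c12 by auto
  next
    fix i assume "i \<in> {?c 0}"
    then have i: "num i = 0" using num_cs[OF m0] by simp
    then have "num ` insert i ?T = {0, 1, Suc 1}" using c12 by auto
    then have "tri (insert i ?T)" unfolding tri_def using m by (intro exI[of _ 1]) auto
    moreover have "i \<notin> ?T" using i c12 by auto
    ultimately show "i \<in> {i. i \<notin> ?T \<and> tri (insert i ?T)}" by blast
  qed
  have "ksgn num (?c 0) ?T = (1 :: ('v, 'k) mpoly)"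
    using c12 num_cs[OF m0] by (simp add: ksgn_pair)
  then have bd_T: "?bd z ?T = monom (ex ?T)" unfolding bd_z apex by simp
  \<comment> \<open>\<open>j\<close> is the error of filling \<open>z\<close> by \<open>t\<close>:
    it has the same boundary as \<open>z\<close>, but its values on 3-element sets lie in
    \<open>J\<close>.\<close>
  define j where "j S = z S - ?bd t S" for S
  have "?bd j ?T = monom (ex ?T)"
    unfolding j_def by (simp only: kbd_diff kbd_kbd[OF num] bd_T diff_0_right)
  moreover have "lookup (?bd j ?T) (expo (ex ?T)) = 0"
    unfolding kbd_def lookup_sum
  proof (rule sum.neutral, rule ballI)
    fix i assume "i \<in> - ?T"
    then have i: "i \<notin> ?T" by simp
    have "lookup (Var i ^ W i * j (insert i ?T)) (expo (ex ?T)) = 0"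
    proof (cases "(\<lambda>v. if v = i then W i else 0) \<le> ex ?T")
      case True
      have "W i \<le> w i" using le_funD[OF True, of i] i by (simp add: ex_def)
      then have "i \<in> set cs" by (auto simp: W_def split: if_splits)
      then obtain k where k: "k < ?m" "i = ?c k" by (metis in_set_conv_nth)
      have k12: "k \<noteq> 1" "k \<noteq> 2" using i k by auto
      \<comment> \<open>On a polygon with at least 4 vertices, no third vertex is next to both ends
        of a side; so the triple contains an edge of the graph.\<close>
      have "\<exists>l\<in>{1, 2}. underlying_adj E (?c k) (?c l)"
      proof (cases "k = 0")
        case True
        then show ?thesis using adj[of 0 2] m m0 by (intro bexI[of _ 2]) auto
      next
        case False
        then show ?thesis using adj[of k 1] k k12 m by (intro bexI[of _ 1]) (auto simp: mod_Suc)
      qed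
      then obtain p q where pq: "(p, q) \<in> E" "p \<in> insert i ?T" "q \<in> insert i ?T"
        unfolding underlying_adj_def using k(2) by auto
      have "card (insert i ?T) = 3" using i \<open>?c 1 \<noteq> ?c 2\<close> by simp
      then have j_in: "j (insert i ?T) \<in> var_prime {p, q}" using t J_sub[OF pq(1)] unfolding j_def by blast
      \<comment> \<open>The exponent left after dividing by the power of \<open>Var i\<close>. It
        vanishes on the whole triple, whereas terms of elements of \<open>J\<close> involve
        \<open>p\<close> or \<open>q\<close>.\<close>
      let ?e = "\<lambda>v. ex ?T v - (if v = i then W i else 0)"
      have e0: "?e u = 0" if "u \<in> insert i ?T" for u
        using that i \<open>i \<in> set cs\<close> by (cases "u = i") (simp_all add: ex_def W_def)
      have "expo ?e \<notin> keys (j (insert i ?T))"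
      proof
        assume "expo ?e \<in> keys (j (insert i ?T))"
        then obtain u where "u \<in> {p, q}" "lookup (expo ?e) u \<noteq> 0"
          using j_in unfolding var_prime_def by blast
        moreover from this(1) have "?e u = 0" using pq(2,3) by (intro e0) blast
        ultimately show False by (simp only: lookup_Abs_poly_mapping finite)
      qed
      then show ?thesis by (simp add: Var_power lookup_monom_times in_keys_iff)
    qed (simp add: Var_power lookup_monom_times)
    moreover have "ksgn num i ?T = (1 :: ('v, 'k) mpoly) \<or> ksgn num i ?T = (- 1 :: ('v, 'k) mpoly)"
      by (rule ksgn_cases)
    ultimately show "lookup (ksgn num i ?T * Var i ^ W i * j (insert i ?T)) (expo (ex ?T)) = 0"
      by auto
  qed
  ultimately show False by (simp add: monom_def)
qed

theorem theorem5p7: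
  fixes E :: "('v::finite \<times> 'v) set" and w :: "'v \<Rightarrow> nat"
  assumes "weighted_oriented_graph E w"
    and "cohen_macaulay_quot (alexander_dual (edge_ideal E w :: ('v, 'k::field) mpoly set))"
  shows "chordal (complement_adj (underlying_adj E))"
  unfolding chordal_def
proof (intro allI impI, rule ccontr)
  fix cs assume cyc: "induced_cycle (complement_adj (underlying_adj E)) cs" and "\<not> length cs < 4"
  then have m: "4 \<le> length cs" by simp
  let ?J = "alexander_dual (edge_ideal E w) :: ('v, 'k) mpoly set"
  let ?m = "length cs"
  have dist: "distinct cs" using cyc by (simp add: induced_cycle_def)
  have "card (set cs) \<le> card (UNIV :: 'v set)" by (rule card_mono) auto
  then have n: "4 \<le> card (UNIV :: 'v set)" using m dist by (simp add: distinct_card)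
  \<comment> \<open>Vertices two apart on the induced cycle are not adjacent in the complement,
    which provides an edge for the dimension bound.\<close>
  have "cs ! 0 \<noteq> cs ! 2"
    using nth_eq_iff_index_eq[OF dist, of 0 2] m by linarith
  moreover have "\<not> complement_adj (underlying_adj E) (cs ! 0) (cs ! 2)"
  proof -
    have "\<And>i j. i < ?m \<Longrightarrow> j < ?m \<Longrightarrow>
        complement_adj (underlying_adj E) (cs ! i) (cs ! j) \<longleftrightarrow> (j = (i + 1) mod ?m \<or> i = (j + 1) mod ?m)"
      using cyc unfolding induced_cycle_def by blast
    moreover have "0 < ?m" "2 < ?m" "3 \<le> ?m" "3 < ?m" using m by linarith+
    ultimately show ?thesis by simp
  qed
  ultimately obtain p q where pq: "(p, q) \<in> E" by (auto simp: complement_adj_def underlying_adj_def)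
  have "enat (card (UNIV :: 'v set) - 2) \<le> krull_dim_quot ?J"
    using alexander_dual_subset_var_prime[OF assms(1) pq] edge_distinct[OF assms(1) pq]
    by (rule krull_dim_quot_ge)
  then have "enat (card (UNIV :: 'v set) - 2) \<le> depth_quot ?J"
    using assms(2) by (simp add: cohen_macaulay_quot_def)
  \<comment> \<open>The depth is a supremum, so a strict bound is needed to extract a regular
    sequence, of length at least \<open>n - 2\<close> for \<open>n\<close> vertices.\<close>
  moreover have "enat (card (UNIV :: 'v set) - 3) < enat (card (UNIV :: 'v set) - 2)"
    using n by simp
  ultimately have "enat (card (UNIV :: 'v set) - 3) < depth_quot ?J" by (rule less_le_trans[rotated])
  then obtain fs where fs: "regular_seq_quot ?J fs" "card (UNIV :: 'v set) - 3 < length fs"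
    unfolding depth_quot_def less_SUP_iff by auto
  obtain f :: "'v \<Rightarrow> nat" where f: "inj f"
    using finite_imp_inj_to_nat_seg[OF finite_UNIV] by blast
  \<comment> \<open>Vertices of the cycle are numbered by position; all others follow, shifted by
    \<open>?m\<close> to keep \<open>num\<close> injective.\<close>
  define num where "num v = (if v \<in> set cs then the_inv_into {..<?m} ((!) cs) v else ?m + f v)" for v
  have bij: "bij_betw ((!) cs) {..<?m} (set cs)" by (rule bij_betw_nth[OF dist]) auto
  have num_cs: "num (cs ! k) = k" if "k < ?m" for k
    using that bij by (simp add: num_def the_inv_into_f_f bij_betw_def)
  have num_inj: "inj num"
  proof (rule injI)
    fix x y assume eq: "num x = num y"
    have lt: "num v < ?m \<longleftrightarrow> v \<in> set cs" for v
    proof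
      assume "num v < ?m"
      then show "v \<in> set cs" by (simp add: num_def split: if_splits)
    next
      assume "v \<in> set cs"
      then show "num v < ?m" using num_cs by (metis in_set_conv_nth)
    qed
    show "x = y"
    proof (cases "x \<in> set cs")
      case True
      then have "y \<in> set cs" using eq lt by metis
      then show ?thesis using True eq num_cs by (metis in_set_conv_nth)
    next
      case False
      then have "y \<notin> set cs" using eq lt by metis
      then show ?thesis using False eq f by (simp add: num_def inj_eq)
    qed
  qed
  have J: "is_ideal ?J" unfolding alexander_dual_def by (rule is_ideal_ideal_gen)
  have "\<not> kexact num (\<lambda>i. Var i ^ (if i \<in> set cs then w i else Suc (w i))) ?J 3"
    using num_inj cyc m num_cs edge_distinct[OF assms(1)] J alexander_dual_subset_var_prime[OF assms(1)] monom_mem_alexander_dual[OF assms(1)]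
    by (rule not_kexact_cycle)
  moreover have "kexact num (\<lambda>i. Var i ^ (if i \<in> set cs then w i else Suc (w i))) ?J 3"
    using fs n by (intro kexact_regular_seq[OF fs(1) num_inj J]) auto
  ultimately show False by blast
qed

end
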